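(* Let $\mathcal D_n$ be the type D Coxeter arrangement in $\mathbb C^n$, consisting of the $n(n-1)$ hyperplanes $H^{\pm}_{i,j}=\ker(x_i\pm x_j)$, $1\le i<j\le n$. Then every irreducible component of $\mathcal R^1(\mathcal D_n)\subseteq\Bbbk^{n(n-1)}$ is two-dimensional, and the components are precisely the following $5\binom n3+9\binom n4$ subspaces: for each triple $i<j<k$, the four components arising from the subarrangements $\{H^-_{i,j},H^-_{i,k},H^-_{j,k}\}$, $\{H^+_{i,j},H^-_{i,k},H^+_{j,k}\}$, $\{H^-_{i,j},H^+_{i,k},H^+_{j,k}\}$, $\{H^+_{i,j},H^+_{i,k},H^-_{j,k}\}$ (each lattice-isomorphic to $\mathcal A_3$) and the one arising from $\{H^\pm_{i,j},H^\pm_{i,k},H^\pm_{j,k}\}$ (lattice-isomorphic to $\mathcal A_4$); and for each quadruple $i<j<k<l$, the eight components arising from the eight subarrangements of $\{H^\pm_{p,q}: p<q,\ p,q\in\{i,j,k,l\}\}$ lattice-isomorphic to $\mathcal A_4$ (those of the form $\{H^{\epsilon_p\epsilon_q}_{p,q}\}$ obtained from a sign vector $(\epsilon_i,\epsilon_j,\epsilon_k,\epsilon_l)$ up to global sign, where $H^{\epsilon}_{p,q}=\ker(x_p-\epsilon x_q)$-type, i.e. the images of $\mathcal A_4$ under sign changes of coordinates) and the one arising from that whole subarrangement (isomorphic to $\mathcal D_4$).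
   Context: $\Bbbk$ is algebraically closed of characteristic $0$; $\mathcal R^1(\mathcal A)$ is the first resonance variety of the Orlik–Solomon algebra $A=H^*(M(\mathcal A);\Bbbk)$ of the complement: $\{a\in A^1: H^1(A,a)\ne0\}$, with $A^1=\Bbbk^{|\mathcal A|}$. $\mathcal A_n$ denotes the braid arrangement $\{\ker(x_i-x_j)\}_{1\le i<j\le n}$ in $\mathbb C^n$ (so $\mathcal A_3$ has 3 and $\mathcal A_4$ has 6 hyperplanes). Each irreducible component of $\mathcal R^1(\mathcal A)$ arises from a nontrivial neighborly partition of a subarrangement $\mathcal A'$ and is contained in the coordinate subspace spanned by $\mathcal A'$; each subarrangement lattice-isomorphic to $\mathcal A_3$, $\mathcal A_4$, or $\mathcal D_4$ supports a $2$-dimensional component (for $\mathcal A_3$ this is $\{u\in\Bbbk^{\mathcal A'}:\sum u_H=0\}$). The eight $\mathcal A_4$-type subarrangements for $i<j<k<l$ are the sets $\{H^{s_{p,q}}_{p,q}\}$ with sign patterns: $(----\,--)$, $(+++\,---)$, $(-++\,++-)$, $(--+\,++-)$, $(+-+\,+-+)$, $(-+-\,+-+)$, $(++-\,-++)$, $(+--\,-++)$, listing signs for $(i,j),(i,k),(i,l),(j,k),(j,l),(k,l)$.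
   Formalization: The formal theorem assumes n ≥ 3; for n = 2 the arrangement D_2 has two hyperplanes and its resonance variety is {0}, a zero-dimensional component not in the list, so the statement fails there. *)

theory Defs
  imports Complex_Main "HOL-Computational_Algebra.Polynomial" "HOL-Library.Function_Algebras"
begin

(* Hyperplanes of D_n: (i,j,s) with 1 <= i < j <= n;
   s = False : H^-_{i,j} = ker(x_i - x_j),   s = True : H^+_{i,j} = ker(x_i + x_j). *)
type_synonym hyp = "nat \<times> nat \<times> bool"

definition Hyp :: "nat \<Rightarrow> hyp set" where
  "Hyp n = {(i,j,s). 1 \<le> i \<and> i < j \<and> j \<le> n}"

definition form :: "hyp \<Rightarrow> nat \<Rightarrow> complex" where
  "form H m = (case H of (i,j,s) \<Rightarrow>
      (if m = i then 1 else if m = j then (if s then 1 else -1) else 0))"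

definition dependent3 :: "hyp \<Rightarrow> hyp \<Rightarrow> hyp \<Rightarrow> bool" where
  "dependent3 H1 H2 H3 \<longleftrightarrow>
     (\<exists>c1 c2 c3 :: complex. (c1, c2, c3) \<noteq> (0, 0, 0) \<and>
        (\<forall>m. c1 * form H1 m + c2 * form H2 m + c3 * form H3 m = 0))"

definition ambient :: "nat \<Rightarrow> (hyp \<Rightarrow> 'k::zero) set" where
  "ambient n = {u. \<forall>h. h \<notin> Hyp n \<longrightarrow> u h = 0}"

(* degree-2 part of the exterior algebra E, elements as alternating functions of pairs *)
definition e2 :: "hyp \<Rightarrow> hyp \<Rightarrow> hyp \<times> hyp \<Rightarrow> 'k::comm_ring_1" where
  "e2 H K = (\<lambda>(x,y). if x = H \<and> y = K then 1 else if x = K \<and> y = H then -1 else 0)"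

definition wedge :: "(hyp \<Rightarrow> 'k::comm_ring_1) \<Rightarrow> (hyp \<Rightarrow> 'k) \<Rightarrow> hyp \<times> hyp \<Rightarrow> 'k" where
  "wedge a b = (\<lambda>(x,y). a x * b y - a y * b x)"

(* boundary  \<partial>(e_{H1} e_{H2} e_{H3}) = e_{H2}e_{H3} - e_{H1}e_{H3} + e_{H1}e_{H2} *)
definition bd3 :: "hyp \<times> hyp \<times> hyp \<Rightarrow> hyp \<times> hyp \<Rightarrow> 'k::comm_ring_1" where
  "bd3 t = (case t of (H1,H2,H3) \<Rightarrow> (\<lambda>p. e2 H2 H3 p - e2 H1 H3 p + e2 H1 H2 p))"

definition dep_triples :: "nat \<Rightarrow> (hyp \<times> hyp \<times> hyp) set" where
  "dep_triples n = {(H1,H2,H3). H1 \<in> Hyp n \<and> H2 \<in> Hyp n \<and> H3 \<in> Hyp n \<and>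
      H1 \<noteq> H2 \<and> H1 \<noteq> H3 \<and> H2 \<noteq> H3 \<and> dependent3 H1 H2 H3}"

definition OS_ideal2 :: "nat \<Rightarrow> (hyp \<times> hyp \<Rightarrow> 'k::comm_ring_1) set" where
  "OS_ideal2 n = {\<omega>. \<exists>T c. finite T \<and> T \<subseteq> dep_triples n \<and>
                        \<omega> = (\<lambda>p. \<Sum>t\<in>T. c t * bd3 t p)}"

(* R^1(D_n) = {a \<in> A^1 : H^1(A,a) \<noteq> 0},  H^1(A,a) = ker(a\<cdot> : A^1 \<rightarrow> A^2) / (a\<cdot>)(A^0) *)
definition resonance1 :: "nat \<Rightarrow> (hyp \<Rightarrow> 'k::field) set" where
  "resonance1 n = {a \<in> ambient n. \<exists>b \<in> ambient n.
       wedge a b \<in> OS_ideal2 n \<and> (\<forall>c. b \<noteq> (\<lambda>h. c * a h))}"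

inductive polyfun :: "(('i \<Rightarrow> 'k::comm_ring_1) \<Rightarrow> 'k) \<Rightarrow> bool" where
  pf_const: "polyfun (\<lambda>u. c)"
| pf_coord: "polyfun (\<lambda>u. u i)"
| pf_add: "polyfun f \<Longrightarrow> polyfun g \<Longrightarrow> polyfun (\<lambda>u. f u + g u)"
| pf_mult: "polyfun f \<Longrightarrow> polyfun g \<Longrightarrow> polyfun (\<lambda>u. f u * g u)"

definition zclosed :: "('i \<Rightarrow> 'k::comm_ring_1) set \<Rightarrow> ('i \<Rightarrow> 'k) set \<Rightarrow> bool" where
  "zclosed V S \<longleftrightarrow> (\<exists>F. (\<forall>f\<in>F. polyfun f) \<and> S = {u \<in> V. \<forall>f\<in>F. f u = 0})"

definition zirreducible :: "('i \<Rightarrow> 'k::comm_ring_1) set \<Rightarrow> ('i \<Rightarrow> 'k) set \<Rightarrow> bool" where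
  "zirreducible V X \<longleftrightarrow> X \<noteq> {} \<and> X \<subseteq> V \<and>
     (\<forall>Y Z. zclosed V Y \<longrightarrow> zclosed V Z \<longrightarrow> X \<subseteq> Y \<union> Z \<longrightarrow> X \<subseteq> Y \<or> X \<subseteq> Z)"

definition irr_components :: "('i \<Rightarrow> 'k::comm_ring_1) set \<Rightarrow> ('i \<Rightarrow> 'k) set \<Rightarrow> ('i \<Rightarrow> 'k) set set" where
  "irr_components V R = {X. X \<subseteq> R \<and> zirreducible V X \<and>
     (\<forall>Y. zirreducible V Y \<and> Y \<subseteq> R \<and> X \<subseteq> Y \<longrightarrow> Y = X)}"

(* Resonance component determined by a neighborly partition P (a multinet with all
   multiplicities 1) of a subarrangement \<Union>P:
   { \<Sum>_B c_B \<cdot> (\<Sum>_{H\<in>B} e_H) : \<Sum>_B c_B = 0 }.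
   For singleton blocks (A_3) this is {u supported on A' : \<Sum> u_H = 0}. *)
definition partition_space :: "hyp set set \<Rightarrow> (hyp \<Rightarrow> 'k::comm_ring_1) set" where
  "partition_space P = {u. \<exists>c. (\<Sum>B\<in>P. c B) = 0 \<and> (\<forall>B\<in>P. \<forall>H\<in>B. u H = c B) \<and>
                              (\<forall>H. H \<notin> \<Union>P \<longrightarrow> u H = 0)}"

abbreviation hm :: "nat \<Rightarrow> nat \<Rightarrow> hyp" where "hm p q \<equiv> (p, q, False)"
abbreviation hp :: "nat \<Rightarrow> nat \<Rightarrow> hyp" where "hp p q \<equiv> (p, q, True)"

definition singletons :: "hyp set \<Rightarrow> hyp set set" where
  "singletons S = (\<lambda>H. {H}) ` S"

definition triple_partitions :: "nat \<Rightarrow> nat \<Rightarrow> nat \<Rightarrow> hyp set set set" where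
  "triple_partitions i j k =
     { singletons {hm i j, hm i k, hm j k},
       singletons {hp i j, hm i k, hp j k},
       singletons {hm i j, hp i k, hp j k},
       singletons {hp i j, hp i k, hm j k},
       { {hp i j, hm i j}, {hp i k, hm i k}, {hp j k, hm j k} } }"

(* A_4-type subarrangement of the quadruple i<j<k<l given by a sign vector \<epsilon>:
   H_{p,q} = ker(x_p - \<epsilon>_p \<epsilon>_q x_q), i.e. sign + iff \<epsilon>_p \<noteq> \<epsilon>_q;
   its neighborly partition pairs hyperplanes with disjoint index pairs *)
definition quad_A4_partition :: "(nat \<Rightarrow> bool) \<Rightarrow> nat \<Rightarrow> nat \<Rightarrow> nat \<Rightarrow> nat \<Rightarrow> hyp set set" where
  "quad_A4_partition \<epsilon> i j k l =
     (let h = (\<lambda>p q. (p, q, \<epsilon> p \<noteq> \<epsilon> q)) in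
       { {h i j, h k l}, {h i k, h j l}, {h i l, h j k} })"

definition quad_D4_partition :: "nat \<Rightarrow> nat \<Rightarrow> nat \<Rightarrow> nat \<Rightarrow> hyp set set" where
  "quad_D4_partition i j k l =
     { {hp i j, hm i j, hp k l, hm k l},
       {hp i k, hm i k, hp j l, hm j l},
       {hp i l, hm i l, hp j k, hm j k} }"

definition quad_partitions :: "nat \<Rightarrow> nat \<Rightarrow> nat \<Rightarrow> nat \<Rightarrow> hyp set set set" where
  "quad_partitions i j k l =
     insert (quad_D4_partition i j k l) {quad_A4_partition \<epsilon> i j k l | \<epsilon>. True}"

definition Dn_components :: "nat \<Rightarrow> (hyp \<Rightarrow> 'k::comm_ring_1) set set" where
  "Dn_components n =
     partition_space `
       ((\<Union>i\<in>{1..n}. \<Union>j\<in>{1..n}. \<Union>k\<in>{1..n}.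
           if i < j \<and> j < k then triple_partitions i j k else {}) \<union>
        (\<Union>i\<in>{1..n}. \<Union>j\<in>{1..n}. \<Union>k\<in>{1..n}. \<Union>l\<in>{1..n}.
           if i < j \<and> j < k \<and> k < l then quad_partitions i j k l else {}))"

definition kdim :: "(hyp \<Rightarrow> 'k::field) set \<Rightarrow> nat" where
  "kdim V = vector_space.dim (\<lambda>c (u::hyp \<Rightarrow> 'k). (\<lambda>h. c * u h)) V"

end

theory Submission
  imports Defs "HOL-Library.Disjoint_Sets"
begin

text \<open>
  Every rank-two flat of \<open>D\<^sub>n\<close> has two or three elements, so \<open>a \<and> b\<close> lies in the Orlik--Solomon ideal iff
  the vectors \<open>v\<^sub>H = (a\<^sub>H, b\<^sub>H)\<close> in the plane are parallel for commuting \<open>H\<close> and, on every triple flat,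
  either pairwise parallel or linearly spanning with sum zero. If \<open>a\<close> and \<open>b\<close> are independent, some triple
  flat carries a spanning triple \<open>X + Y + Z = 0\<close>; a change of signs of the coordinates turns it into
  \<open>x\<^sub>i = x\<^sub>j = x\<^sub>k\<close>. Parallelism and the other triple flats then make every \<open>v\<^sub>H\<close> zero or one of
  \<open>X\<close>, \<open>Y\<close>, \<open>Z\<close>, and let at most one further index \<open>l\<close> take part, which leaves exactly the listed partitions.
  The resonance variety is therefore a finite union of planes \<open>C\<^sub>P\<close>. Planes are irreducible (restrict
  polynomials to lines), and \<open>C\<^sub>P \<subseteq> C\<^sub>Q\<close> implies \<open>P = Q\<close>, because for blocks \<open>B\<close>, \<open>B'\<close> of \<open>P\<close> the difference
  of their indicator functions lies in \<open>C\<^sub>Q\<close>, which forces \<open>B\<close> to be a block of \<open>Q\<close>.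
\<close>

subsection \<open>Zariski-closed sets and partition spaces\<close>

text \<open>All kinds of components are treated as one family, given by an index set
  \<open>S\<close> of size 3 or 4, a sign vector and a Boolean \<open>full\<close>. Without
  \<open>full\<close> this is a braid arrangement after a change of signs (\<open>A_3\<close> or
  \<open>A_4\<close>); with \<open>full\<close> it is \<open>D_3\<close> or \<open>D_4\<close>, and
  \<open>D_3\<close> is the arrangement of type \<open>A_4\<close> attached to a triple. Sign
  vectors matter only up to complement, whence 4 + 1 partitions per triple and 8 + 1 per quadruple.
  The factors 0 and 1 come from idempotents: a flat in which two vectors carry the same factor
  \<open>m\<close> relative to the reference vectors yields \<open>m * m = m\<close>. At most one
  further index occurs because hyperplanes over \<open>{i,l}\<close> and \<open>{j,l'}\<close> with
  distinct \<open>l\<close>, \<open>l'\<close> commute, although nonzero vectors there would be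
  multiples of the independent \<open>Z\<close> and \<open>Y\<close>. Hyperplanes are stored with
  increasing indices, whereas the classification is symmetric in the indices. It is therefore
  carried out for functions of unordered index pairs, with signs combined by exclusive or, and then
  translated back.\<close>

lemma polyfun_restrict_line:
  assumes "polyfun f"
  shows "\<exists>P. \<forall>t. poly P t = f (\<lambda>i. x i + t * y i)"
  using assms
proof induction
  case (pf_const c)
  show ?case by (rule exI[of _ "[:c:]"]) simp
next
  case (pf_coord i)
  show ?case by (rule exI[of _ "[:x i, y i:]"]) simp
next
  case (pf_add f g)
  then obtain P Q where "\<forall>t. poly P t = f (\<lambda>i. x i + t * y i)"
    "\<forall>t. poly Q t = g (\<lambda>i. x i + t * y i)" by blast
  then show ?case by (intro exI[of _ "P + Q"]) simp
next
  case (pf_mult f g)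
  then obtain P Q where "\<forall>t. poly P t = f (\<lambda>i. x i + t * y i)"
    "\<forall>t. poly Q t = g (\<lambda>i. x i + t * y i)" by blast
  then show ?case by (intro exI[of _ "P * Q"]) simp
qed

text \<open>If \<open>Y\<close> misses \<open>x\<close> and \<open>Z\<close> misses
  \<open>y\<close>, witnessing equations \<open>f\<close> and \<open>g\<close> restrict to nonzero
  univariate polynomials on the line through \<open>x\<close> and \<open>y\<close>. That line stays
  in \<open>X\<close>, so their product vanishes at every parameter, which is impossible over an
  infinite field.\<close>

lemma zirreducible_if_lines:
  fixes X :: "('i \<Rightarrow> 'k::field_char_0) set"
  assumes "X \<noteq> {}" and "X \<subseteq> V"
    and lines: "\<And>x y t. x \<in> X \<Longrightarrow> y \<in> X \<Longrightarrow> (\<lambda>i. x i + t * (y i - x i)) \<in> X"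
  shows "zirreducible V X"
  unfolding zirreducible_def
proof (intro conjI allI impI assms(1,2))
  fix Y Z
  assume "zclosed V Y" "zclosed V Z" and cover: "X \<subseteq> Y \<union> Z"
  then obtain F G where F: "\<forall>f\<in>F. polyfun f" "Y = {u \<in> V. \<forall>f\<in>F. f u = 0}"
    and G: "\<forall>f\<in>G. polyfun f" "Z = {u \<in> V. \<forall>f\<in>G. f u = 0}"
    unfolding zclosed_def by blast
  show "X \<subseteq> Y \<or> X \<subseteq> Z"
  proof (rule ccontr)
    assume "\<not> ?thesis"
    then obtain x y f g where xy: "x \<in> X" "y \<in> X" and f: "f \<in> F" "f x \<noteq> 0"
      and g: "g \<in> G" "g y \<noteq> 0"
      using F(2) G(2) assms(2) by blast
    let ?l = "\<lambda>t i. x i + t * (y i - x i)"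
    obtain P where P: "\<And>t. poly P t = f (?l t)"
      using polyfun_restrict_line[of f x "\<lambda>i. y i - x i"] F(1) f(1) by blast
    obtain Q where Q: "\<And>t. poly Q t = g (?l t)"
      using polyfun_restrict_line[of g x "\<lambda>i. y i - x i"] G(1) g(1) by blast
    have "poly (P * Q) t = 0" for t
    proof -
      have "?l t \<in> Y \<union> Z" using lines[OF xy, of t] cover by blast
      then show ?thesis using F(2) G(2) f(1) g(1) P[of t] Q[of t] by auto
    qed
    then have "P * Q = 0" using poly_all_0_iff_0 by blast
    moreover have "poly P 0 \<noteq> 0" "poly Q 1 \<noteq> 0" using f(2) g(2) by (simp_all add: P Q)
    ultimately show False by auto
  qed
qed

lemma zclosed_Un:
  fixes Y Z :: "('i \<Rightarrow> 'k::field) set"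
  assumes "zclosed V Y" "zclosed V Z"
  shows "zclosed V (Y \<union> Z)"
proof -
  obtain F G where F: "\<forall>f\<in>F. polyfun f" "Y = {u \<in> V. \<forall>f\<in>F. f u = 0}"
    and G: "\<forall>f\<in>G. polyfun f" "Z = {u \<in> V. \<forall>f\<in>G. f u = 0}"
    using assms unfolding zclosed_def by blast
  let ?H = "{(\<lambda>u. f u * g u) |f g. f \<in> F \<and> g \<in> G}"
  have "\<forall>h\<in>?H. polyfun h" using F(1) G(1) by (auto intro: pf_mult)
  moreover have "Y \<union> Z = {u \<in> V. \<forall>h\<in>?H. h u = 0}"
    unfolding F(2) G(2) by auto (metis mult_eq_0_iff)
  ultimately show ?thesis unfolding zclosed_def by blast
qed

lemma zclosed_Union:
  fixes \<C> :: "('i \<Rightarrow> 'k::field) set set"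
  assumes "finite \<C>" "\<And>C. C \<in> \<C> \<Longrightarrow> zclosed V C"
  shows "zclosed V (\<Union>\<C>)"
  using assms
proof (induction \<C>)
  case empty
  have "zclosed V ({} :: ('i \<Rightarrow> 'k) set)"
    unfolding zclosed_def by (intro exI[of _ "{\<lambda>u. 1}"]) (auto intro: pf_const)
  then show ?case by simp
qed (auto intro: zclosed_Un)

lemma zirreducible_subset_Union:
  fixes \<C> :: "('i \<Rightarrow> 'k::field) set set"
  assumes "finite \<C>" "\<And>C. C \<in> \<C> \<Longrightarrow> zclosed V C" "zirreducible V X" "X \<subseteq> \<Union>\<C>"
  shows "\<exists>C\<in>\<C>. X \<subseteq> C"
  using assms
proof (induction \<C>)
  case empty
  then show ?case by (auto simp: zirreducible_def)
next
  case (insert C \<C>)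
  have "zclosed V (\<Union>\<C>)" using insert by (intro zclosed_Union) auto
  then have "X \<subseteq> C \<or> X \<subseteq> \<Union>\<C>"
    using insert.prems unfolding zirreducible_def by simp
  then show ?case using insert by auto
qed

text \<open>An irreducible subset of a finite union of closed sets lies in one of them. Hence every
  maximal irreducible subset is a member of \<open>\<C>\<close>, and incomparability makes every
  member maximal.\<close>

lemma irr_components_Union:
  fixes \<C> :: "('i \<Rightarrow> 'k::field) set set"
  assumes fin: "finite \<C>"
    and cl: "\<And>C. C \<in> \<C> \<Longrightarrow> zclosed V C"
    and irr: "\<And>C. C \<in> \<C> \<Longrightarrow> zirreducible V C"
    and anti: "\<And>C D. C \<in> \<C> \<Longrightarrow> D \<in> \<C> \<Longrightarrow> C \<subseteq> D \<Longrightarrow> C = D"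
  shows "irr_components V (\<Union>\<C>) = \<C>"
proof (rule set_eqI)
  fix X
  have cover: "\<exists>C\<in>\<C>. Y \<subseteq> C" if "zirreducible V Y" "Y \<subseteq> \<Union>\<C>" for Y
    using zirreducible_subset_Union[OF fin cl that] .
  show "X \<in> irr_components V (\<Union>\<C>) \<longleftrightarrow> X \<in> \<C>"
  proof
    assume X: "X \<in> irr_components V (\<Union>\<C>)"
    then have X': "zirreducible V X" "X \<subseteq> \<Union>\<C>"
      and max: "\<And>Y. zirreducible V Y \<Longrightarrow> Y \<subseteq> \<Union>\<C> \<Longrightarrow> X \<subseteq> Y \<Longrightarrow> Y = X"
      unfolding irr_components_def by blast+
    obtain C where C: "C \<in> \<C>" "X \<subseteq> C" using cover[OF X'] by blast
    then have "C = X" using max[OF irr[OF C(1)] Union_upper[OF C(1)] C(2)] by simp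
    then show "X \<in> \<C>" using C(1) by simp
  next
    assume X: "X \<in> \<C>"
    have "Y = X" if Y: "zirreducible V Y" "Y \<subseteq> \<Union>\<C>" "X \<subseteq> Y" for Y
    proof -
      obtain C where "C \<in> \<C>" "Y \<subseteq> C" using cover Y by blast
      then show ?thesis using anti[OF X, of C] Y(3) by blast
    qed
    then show "X \<in> irr_components V (\<Union>\<C>)"
      using irr[OF X] Union_upper[OF X] unfolding irr_components_def by simp
  qed
qed

section \<open>Partition spaces: closedness, irreducibility, incomparability, dimension\<close>

lemma partition_space_lincomb:
  assumes "u \<in> partition_space P" "v \<in> partition_space P"
  shows "(\<lambda>h. x * u h + y * v h) \<in> partition_space P"
proof -
  obtain c where c: "(\<Sum>B\<in>P. c B) = 0" "\<forall>B\<in>P. \<forall>H\<in>B. u H = c B" "\<forall>H. H \<notin> \<Union>P \<longrightarrow> u H = 0"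
    using assms(1) unfolding partition_space_def by blast
  obtain d where d: "(\<Sum>B\<in>P. d B) = 0" "\<forall>B\<in>P. \<forall>H\<in>B. v H = d B" "\<forall>H. H \<notin> \<Union>P \<longrightarrow> v H = 0"
    using assms(2) unfolding partition_space_def by blast
  have "(\<Sum>B\<in>P. x * c B + y * d B) = 0"
    using c(1) d(1) by (simp add: sum.distrib sum_distrib_left[symmetric])
  then show ?thesis
    using c(2,3) d(2,3) unfolding partition_space_def
    by (intro CollectI exI[of _ "\<lambda>B. x * c B + y * d B"]) auto
qed

text \<open>The existentially quantified coefficients must be replaced by polynomial equations in
  \<open>u\<close> itself. Since blocks are nonempty, the coefficient of \<open>B\<close> can be
  read off at a chosen representative \<open>r B\<close>; the equations then express sum zero,
  constancy on blocks and support.\<close>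

lemma partition_space_zclosed:
  assumes "finite P" "{} \<notin> P" "\<Union>P \<subseteq> Hyp n"
  shows "zclosed (ambient n) (partition_space P :: (hyp \<Rightarrow> 'k::field) set)"
proof -
  obtain r where r: "\<And>B. B \<in> P \<Longrightarrow> r B \<in> B" using assms(2) by (metis ex_in_conv)
  have lin: "polyfun (\<lambda>u :: hyp \<Rightarrow> 'k. \<Sum>B\<in>Q. u (r B))" if "finite Q" for Q
    using that by (induction Q) (auto intro: pf_const pf_add pf_coord)
  have diff: "polyfun (\<lambda>u :: hyp \<Rightarrow> 'k. u H - u K)" for H K
    using pf_add[OF pf_coord pf_mult[OF pf_const[of "-1"] pf_coord], of H K] by simp
  define F where "F = {\<lambda>u. \<Sum>B\<in>P. u (r B)} \<union> {(\<lambda>u. u H - u (r B)) |H B. B \<in> P \<and> H \<in> B}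
    \<union> {(\<lambda>u :: hyp \<Rightarrow> 'k. u H) |H. H \<notin> \<Union>P}"
  have "\<forall>f\<in>F. polyfun f"
  proof
    fix f assume "f \<in> F"
    then consider "f = (\<lambda>u. \<Sum>B\<in>P. u (r B))" | H B where "f = (\<lambda>u. u H - u (r B))"
      | H where "f = (\<lambda>u. u H)" unfolding F_def by blast
    then show "polyfun f" using lin[OF assms(1)] diff pf_coord by cases simp_all
  qed
  moreover have "partition_space P = {u \<in> ambient n. \<forall>f\<in>F. f u = 0}"
  proof (intro set_eqI iffI)
    fix u :: "hyp \<Rightarrow> 'k"
    assume "u \<in> partition_space P"
    then obtain c where c: "(\<Sum>B\<in>P. c B) = 0" "\<And>B H. B\<in>P \<Longrightarrow> H\<in>B \<Longrightarrow> u H = c B"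
      "\<And>H. H \<notin> \<Union>P \<Longrightarrow> u H = 0"
      unfolding partition_space_def by blast
    have "(\<Sum>B\<in>P. u (r B)) = 0" using c(1,2) r by (metis (no_types, lifting) sum.cong)
    then show "u \<in> {u \<in> ambient n. \<forall>f\<in>F. f u = 0}"
    proof (intro CollectI conjI ballI)
      show "u \<in> ambient n" unfolding ambient_def using c(3) assms(3) by blast
    next
      fix f assume "f \<in> F"
      then consider "f = (\<lambda>u. \<Sum>B\<in>P. u (r B))" | H B where "f = (\<lambda>u. u H - u (r B))" "B \<in> P" "H \<in> B"
        | H where "f = (\<lambda>u. u H)" "H \<notin> \<Union>P" unfolding F_def by blast
      then show "f u = 0"
      proof cases
        case 1
        have "(\<Sum>B\<in>P. u (r B)) = (\<Sum>B\<in>P. c B)" using c(2) r by (intro sum.cong) auto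
        then show ?thesis using 1 c(1) by simp
      next
        case (2 H B)
        then show ?thesis using c(2)[of B H] c(2)[of B "r B"] r by simp
      next
        case (3 H)
        then show ?thesis using c(3)[of H] by simp
      qed
    qed
  next
    fix u :: "hyp \<Rightarrow> 'k"
    assume "u \<in> {u \<in> ambient n. \<forall>f\<in>F. f u = 0}"
    then have u: "f u = 0" if "f \<in> F" for f using that by blast
    have "u H - u (r B) = 0" if "B \<in> P" "H \<in> B" for B H
      by (rule u) (use that in \<open>unfold F_def, blast\<close>)
    moreover have "(\<Sum>B\<in>P. u (r B)) = 0" by (rule u) (unfold F_def, blast)
    moreover have "u H = 0" if "H \<notin> \<Union>P" for H by (rule u) (use that in \<open>unfold F_def, blast\<close>)
    ultimately show "u \<in> partition_space P"
      unfolding partition_space_def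
      by (intro CollectI exI[of _ "\<lambda>B. u (r B)"] conjI ballI allI impI) (simp_all only: right_minus_eq)
  qed
  ultimately show ?thesis unfolding zclosed_def by blast
qed

lemma partition_space_zirreducible:
  assumes "\<Union>P \<subseteq> Hyp n"
  shows "zirreducible (ambient n) (partition_space P :: (hyp \<Rightarrow> 'k::field_char_0) set)"
proof (rule zirreducible_if_lines)
  have "(\<lambda>_. 0) \<in> (partition_space P :: (hyp \<Rightarrow> 'k) set)"
    unfolding partition_space_def by (intro CollectI exI[of _ "\<lambda>_. 0"]) auto
  then show "(partition_space P :: (hyp \<Rightarrow> 'k) set) \<noteq> {}" by blast
  show "partition_space P \<subseteq> (ambient n :: (hyp \<Rightarrow> 'k) set)"
    using assms by (fastforce simp: partition_space_def ambient_def)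
next
  fix x y :: "hyp \<Rightarrow> 'k" and t
  assume "x \<in> partition_space P" "y \<in> partition_space P"
  then have "(\<lambda>h. (1 - t) * x h + t * y h) \<in> partition_space P"
    by (rule partition_space_lincomb)
  then show "(\<lambda>h. x h + t * (y h - x h)) \<in> partition_space P"
    by (simp add: algebra_simps)
qed

lemma card_eq_3E:
  assumes "card P = 3"
  obtains A B C where "P = {A, B, C}" "A \<noteq> B" "A \<noteq> C" "B \<noteq> C"
  using assms card_3_iff[of P] by auto

lemma partition_space_block_diff:
  assumes "finite P" "disjoint P" "B \<in> P" "C \<in> P" "B \<noteq> C"
  shows "(\<lambda>H. if H \<in> B then 1 else if H \<in> C then -1 else 0)
    \<in> (partition_space P :: (hyp \<Rightarrow> 'k::field) set)"
proof -
  let ?c = "\<lambda>D. (if D = B then 1 else 0) + (if D = C then -1 else 0 :: 'k)"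
  have "(\<Sum>D\<in>P. ?c D) = 0"
    using assms(1,3,4) by (simp add: sum.distrib)
  then show ?thesis
    using assms(2-5) unfolding partition_space_def
    by (intro CollectI exI[of _ ?c]) (auto simp: disjoint_def)
qed

lemma partition_space_3_iff:
  assumes "A \<noteq> B" "A \<noteq> C" "B \<noteq> C"
  shows "u \<in> partition_space {A, B, C} \<longleftrightarrow> (\<exists>x y z. x + y + z = 0 \<and> (\<forall>H\<in>A. u H = x)
    \<and> (\<forall>H\<in>B. u H = y) \<and> (\<forall>H\<in>C. u H = z) \<and> (\<forall>H. H \<notin> A \<union> B \<union> C \<longrightarrow> u H = 0))"
    (is "_ \<longleftrightarrow> (\<exists>x y z. ?R x y z)")
proof
  have sum: "(\<Sum>D\<in>{A, B, C}. c D) = c A + c B + c C" for c :: "hyp set \<Rightarrow> 'a"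
    using assms by (simp add: add.assoc)
  {
    assume "u \<in> partition_space {A, B, C}"
    then obtain c where "(\<Sum>D\<in>{A, B, C}. c D) = 0" "\<forall>D\<in>{A, B, C}. \<forall>H\<in>D. u H = c D"
      "\<forall>H. H \<notin> \<Union>{A, B, C} \<longrightarrow> u H = 0"
      unfolding partition_space_def by blast
    then have "?R (c A) (c B) (c C)" unfolding sum by simp
    then show "\<exists>x y z. ?R x y z" by blast
  }
  assume "\<exists>x y z. ?R x y z"
  then obtain x y z where R: "?R x y z" by blast
  let ?c = "\<lambda>D. if D = A then x else if D = B then y else z"
  have "(\<Sum>D\<in>{A, B, C}. ?c D) = 0" unfolding sum using R assms by simp
  moreover have "\<forall>D\<in>{A, B, C}. \<forall>H\<in>D. u H = ?c D" using R assms by simp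
  moreover have "\<forall>H. H \<notin> \<Union>{A, B, C} \<longrightarrow> u H = 0" using R by simp
  ultimately show "u \<in> partition_space {A, B, C}" unfolding partition_space_def by blast
qed

text \<open>The three block values lie in \<open>{1, -1, 0}\<close>, have sum zero and include 1.
  Two further possibilities, two or three values equal to 1, would make 1, 2 or 3 vanish, so in
  characteristic 0 exactly one block carries the value 1. A block of \<open>P\<close> is thus
  recovered from a single vector of its space.\<close>

lemma partition_space_unit_level_block:
  fixes u :: "hyp \<Rightarrow> 'k::field_char_0"
  assumes "card P = 3" "{} \<notin> P" "u \<in> partition_space P" "range u \<subseteq> {1, -1, 0}" "u H = 1"
  shows "{H. u H = 1} \<in> P"
proof -
  obtain A B C where P: "P = {A, B, C}" "A \<noteq> B" "A \<noteq> C" "B \<noteq> C"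
    using assms(1) by (rule card_eq_3E)
  obtain x y z where c: "x + y + z = 0" "\<And>H. H \<in> A \<Longrightarrow> u H = x" "\<And>H. H \<in> B \<Longrightarrow> u H = y"
    "\<And>H. H \<in> C \<Longrightarrow> u H = z" "\<And>H. H \<notin> A \<union> B \<union> C \<Longrightarrow> u H = 0"
    using iffD1[OF partition_space_3_iff[OF P(2-4)] assms(3)[unfolded P(1)]] by blast
  have "A \<noteq> {}" "B \<noteq> {}" "C \<noteq> {}" using P(1) assms(2) by auto
  then have "x \<in> range u" "y \<in> range u" "z \<in> range u"
    using c(2-4) by (metis ex_in_conv rangeI)+
  then have vals: "x = 1 \<or> x = -1 \<or> x = 0" "y = 1 \<or> y = -1 \<or> y = 0" "z = 1 \<or> z = -1 \<or> z = 0"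
    using assms(4) by blast+
  have "H \<in> A \<union> B \<union> C" using c(5)[of H] assms(5) by (cases "H \<in> A \<union> B \<union> C") auto
  then have "x = 1 \<or> y = 1 \<or> z = 1" using c(2-4)[of H] assms(5) by auto
  then have "x = 1 \<and> y \<noteq> 1 \<and> z \<noteq> 1 \<or> y = 1 \<and> x \<noteq> 1 \<and> z \<noteq> 1
      \<or> z = 1 \<and> x \<noteq> 1 \<and> y \<noteq> 1"
    using c(1) vals by (elim disjE; simp)
  then have "{H. u H = 1} = A \<or> {H. u H = 1} = B \<or> {H. u H = 1} = C"
  proof (elim disjE)
    assume "x = 1 \<and> y \<noteq> 1 \<and> z \<noteq> 1"
    then have "{H. u H = 1} = A" using c by (auto; metis Un_iff zero_neq_one)
    then show ?thesis by simp
  next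
    assume "y = 1 \<and> x \<noteq> 1 \<and> z \<noteq> 1"
    then have "{H. u H = 1} = B" using c by (auto; metis Un_iff zero_neq_one)
    then show ?thesis by simp
  next
    assume "z = 1 \<and> x \<noteq> 1 \<and> y \<noteq> 1"
    then have "{H. u H = 1} = C" using c by (auto; metis Un_iff zero_neq_one)
    then show ?thesis by simp
  qed
  then show ?thesis using P(1) by auto
qed

lemma partition_space_subset_imp_eq:
  assumes "partition_on X P" "card P = 3" "partition_on Y Q" "card Q = 3"
    and sub: "(partition_space P :: (hyp \<Rightarrow> 'k::field_char_0) set) \<subseteq> partition_space Q"
  shows "P = Q"
proof (rule card_subset_eq)
  show "finite Q" using assms(4) by (simp add: card_ge_0_finite)
  have fP: "finite P" using assms(2) by (simp add: card_ge_0_finite)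
  show "P \<subseteq> Q"
  proof
    fix B assume B: "B \<in> P"
    obtain C where C: "C \<in> P" "B \<noteq> C"
      using assms(2) by (rule card_eq_3E) blast
    let ?u = "\<lambda>H. if H \<in> B then 1 else if H \<in> C then -1 else 0 :: 'k"
    have "?u \<in> partition_space Q"
      using partition_space_block_diff[OF fP _ B C] assms(1) sub by (auto simp: partition_on_def)
    moreover obtain H where "H \<in> B" using B assms(1) by (metis partition_onD3 ex_in_conv)
    ultimately have "{H. ?u H = 1} \<in> Q"
      using assms(3,4) by (intro partition_space_unit_level_block[of Q ?u H]) (auto dest: partition_onD3)
    moreover have "{H. ?u H = 1} = B" by auto
    ultimately show "B \<in> Q" by simp
  qed
qed (use assms in simp)

text \<open>A basis is formed by the indicators of \<open>A\<close> and of \<open>B\<close>, each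
  minus that of \<open>C\<close>: a vector with block values \<open>x\<close>, \<open>y\<close>,
  \<open>- x - y\<close> has coordinates \<open>x\<close> and \<open>y\<close>. One point from
  \<open>A\<close> and one from \<open>B\<close> show independence.\<close>

lemma kdim_partition_space:
  assumes "partition_on X P" "card P = 3"
  shows "kdim (partition_space P :: (hyp \<Rightarrow> 'k::field_char_0) set) = 2"
proof -
  interpret vs: vector_space "\<lambda>c (u :: hyp \<Rightarrow> 'k). (\<lambda>h. c * u h)"
    by unfold_locales (auto simp: fun_eq_iff algebra_simps)
  have P0: "finite P" "disjoint P" "{} \<notin> P"
    using assms by (auto simp: partition_on_def card_ge_0_finite)
  obtain A B C where P: "P = {A, B, C}" and ne: "A \<noteq> B" "A \<noteq> C" "B \<noteq> C"
    using assms(2) by (rule card_eq_3E)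
  let ?d = "\<lambda>D H. if H \<in> D then 1 else if H \<in> C then -1 else 0 :: 'k"
  obtain x y where xy: "x \<in> A" "y \<in> B" using P P0(3) by blast
  then have nin: "x \<notin> B" "x \<notin> C" "y \<notin> A" "y \<notin> C"
    using P P0(2) ne by (auto simp: disjoint_def)
  define a b where "a = ?d A" and "b = ?d B"
  have sub: "{a, b} \<subseteq> partition_space P"
    using partition_space_block_diff[OF P0(1,2)] P ne unfolding a_def b_def by auto
  have val: "a x = 1" "b x = 0" "b y = 1" using xy nin by (simp_all add: a_def b_def)
  have nab: "a \<noteq> (\<lambda>h. k * b h)" for k
  proof
    assume "a = (\<lambda>h. k * b h)"
    then have "a x = k * b x" by (rule fun_cong)
    then show False by (simp add: val)
  qed
  have "b \<noteq> 0" using val(3) by (metis zero_fun_apply zero_neq_one)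
  then have ind: "vs.independent {a, b}"
    using nab by (auto simp: vs.independent_insert vs.span_singleton)
  have card: "card {a, b} = 2" using nab[of 1] by auto
  have "u \<in> vs.span {a, b}" if u: "u \<in> partition_space P" for u
  proof -
    obtain x y z where c: "x + y + z = 0" "\<And>H. H \<in> A \<Longrightarrow> u H = x" "\<And>H. H \<in> B \<Longrightarrow> u H = y"
      "\<And>H. H \<in> C \<Longrightarrow> u H = z" "\<And>H. H \<notin> A \<union> B \<union> C \<Longrightarrow> u H = 0"
      using iffD1[OF partition_space_3_iff[OF ne] u[unfolded P]] by blast
    have z: "z = - x - y" using c(1) by (simp add: algebra_simps eq_neg_iff_add_eq_0)
    have dis: "A \<inter> B = {}" "A \<inter> C = {}" "B \<inter> C = {}" using P P0(2) ne by (simp_all add: disjoint_def)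
    have "u H = x * ?d A H + y * ?d B H" for H
    proof (cases "H \<in> A \<union> B \<union> C")
      case True
      have "\<not> (H \<in> A \<and> H \<in> B)" "\<not> (H \<in> A \<and> H \<in> C)" "\<not> (H \<in> B \<and> H \<in> C)"
        using dis by blast+
      then show ?thesis using True c(2-4)[of H] z by (elim UnE) simp_all
    qed (use c(5)[of H] in simp)
    then have "u = (\<lambda>h. x * a h) + (\<lambda>h. y * b h)" by (simp add: a_def b_def fun_eq_iff)
    moreover have "(\<lambda>h. x * a h) \<in> vs.span {a, b}" "(\<lambda>h. y * b h) \<in> vs.span {a, b}"
      by (rule vs.span_scale[OF vs.span_base]; simp)+
    ultimately show ?thesis by (simp only: vs.span_add)
  qed
  then have "vs.dim (partition_space P) = 2"
    by (intro vs.dim_unique[OF sub subsetI ind card])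
  then show ?thesis unfolding kdim_def .
qed

subsection \<open>The Orlik--Solomon ideal in degree two\<close>

definition ends :: "hyp \<Rightarrow> nat set" where
  "ends H = (case H of (i, j, s) \<Rightarrow> {i, j})"

text \<open>The reflections in \<open>H\<close> and \<open>K\<close> commute. The case
  \<open>H = K\<close> is included on purpose, so that vanishing on commuting pairs also covers the
  diagonal.\<close>

definition commuting :: "hyp \<Rightarrow> hyp \<Rightarrow> bool" where
  "commuting H K \<longleftrightarrow> ends H = ends K \<or> ends H \<inter> ends K = {}"

text \<open>The three-element rank-two flats: two of the hyperplanes eliminate the coordinate they share,
  and the third has the sign \<open>s \<noteq> t\<close> because \<open>True\<close> stands for \<open>+\<close>.\<close>

definition triangles :: "nat \<Rightarrow> (hyp \<times> hyp \<times> hyp) set" where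
  "triangles n = {((i, j, s), (j, k, t), (i, k, s \<noteq> t)) |i j k s t.
     1 \<le> i \<and> i < j \<and> j < k \<and> k \<le> n}"

definition corners :: "hyp \<times> hyp \<times> hyp \<Rightarrow> hyp set" where
  "corners t = (case t of (H1, H2, H3) \<Rightarrow> {H1, H2, H3})"

lemma ends_simp [simp]: "ends (i, j, s) = {i, j}"
  by (simp add: ends_def)

lemma corners_simp [simp]: "corners (H, K, L) = {H, K, L}"
  by (simp add: corners_def)

lemma finite_Hyp: "finite (Hyp n)"
proof (rule finite_subset)
  show "Hyp n \<subseteq> {..n} \<times> {..n} \<times> UNIV" by (auto simp: Hyp_def)
qed simp

lemma form_eq_0_iff: "form H m = 0 \<longleftrightarrow> m \<notin> ends H"
  by (auto simp: form_def ends_def split: prod.splits)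

lemma form_independent2:
  assumes "H \<in> Hyp n" "K \<in> Hyp n" "H \<noteq> K" "\<And>m. c * form H m + d * form K m = 0"
  shows "c = 0" "d = 0"
proof -
  obtain i j s i' j' s' where HK: "H = (i, j, s)" "K = (i', j', s')" by (metis prod_cases3)
  have lt: "i < j" "i' < j'" using assms(1,2) by (auto simp: HK Hyp_def)
  have zero: "m \<in> ends H \<Longrightarrow> d = 0 \<Longrightarrow> c = 0" "m \<in> ends K \<Longrightarrow> c = 0 \<Longrightarrow> d = 0"
    "m \<in> ends H - ends K \<Longrightarrow> c = 0" for m
    using assms(4)[of m] form_eq_0_iff[of H m] form_eq_0_iff[of K m] by auto
  have "c = 0 \<and> d = 0"
  proof (cases "ends H = ends K")
    case True
    then have "i' = i" "j' = j" "s' \<noteq> s" using lt assms(3) by (auto simp: HK doubleton_eq_iff)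
    \<comment> \<open>Over one index pair only the sign differs: both forms have coefficient 1 at
      \<open>i\<close> and opposite coefficients at \<open>j\<close>.\<close>
    then have "c + d = 0" "c - d = 0"
      using assms(4)[of i] assms(4)[of j] lt by (cases s; auto simp: HK form_def algebra_simps)+
    then show ?thesis by (auto simp: eq_iff_diff_eq_0[symmetric] add_eq_0_iff)
  next
    case False
    then have "\<exists>m. m \<in> ends H - ends K" using lt by (auto simp: HK)
    then have "c = 0" using zero(3) by blast
    moreover have "i' \<in> ends K" by (simp add: HK)
    ultimately show ?thesis using zero(2) by blast
  qed
  then show "c = 0" "d = 0" by auto
qed

lemma card_ends: "H \<in> Hyp n \<Longrightarrow> card (ends H) = 2"
  by (auto simp: Hyp_def)

text \<open>\<open>dependent3\<close> only provides one nonzero coefficient. If any coefficient were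
  zero, the other two forms would be dependent, contrary to
  \<open>form_independent2\<close>.\<close>

lemma dep_triples_coeffs:
  assumes "(H1, H2, H3) \<in> dep_triples n"
  obtains c1 c2 c3 where "c1 \<noteq> 0" "c2 \<noteq> 0" "c3 \<noteq> 0"
    "\<And>m. c1 * form H1 m + c2 * form H2 m + c3 * form H3 m = 0"
proof -
  have H: "H1 \<in> Hyp n" "H2 \<in> Hyp n" "H3 \<in> Hyp n" "H1 \<noteq> H2" "H1 \<noteq> H3" "H2 \<noteq> H3"
    "dependent3 H1 H2 H3" using assms by (auto simp: dep_triples_def)
  obtain c1 c2 c3 where c: "(c1, c2, c3) \<noteq> (0, 0, 0)"
    "\<And>m. c1 * form H1 m + c2 * form H2 m + c3 * form H3 m = 0"
    using H(7) unfolding dependent3_def by blast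
  have "c1 \<noteq> 0"
    using form_independent2[of H2 n H3 c2 c3] c H by auto
  moreover have "c2 \<noteq> 0"
    using form_independent2[of H1 n H3 c1 c3] c H by auto
  moreover have "c3 \<noteq> 0"
    using form_independent2[of H1 n H2 c1 c2] c H by auto
  ultimately show thesis using that c(2) by blast
qed

lemma dep_triples_perm:
  assumes "(A, B, C) \<in> dep_triples n"
  shows "(B, A, C) \<in> dep_triples n" "(A, C, B) \<in> dep_triples n"
proof -
  obtain a b c where "a \<noteq> 0" and abc: "\<And>m. a * form A m + b * form B m + c * form C m = 0"
    using dep_triples_coeffs[OF assms] by metis
  then have "(b, a, c) \<noteq> (0, 0, 0)" "(a, c, b) \<noteq> (0, 0, 0)" by simp_all
  moreover have "\<forall>m. b * form B m + a * form A m + c * form C m = 0"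
    "\<forall>m. a * form A m + c * form C m + b * form B m = 0"
    using abc by (simp_all add: algebra_simps)
  ultimately have "dependent3 B A C" "dependent3 A C B"
    unfolding dependent3_def by blast+
  then show "(B, A, C) \<in> dep_triples n" "(A, C, B) \<in> dep_triples n"
    using assms by (auto simp: dep_triples_def)
qed

lemma dep_triples_through:
  assumes "t \<in> dep_triples n" "A \<in> corners t" "B \<in> corners t" "A \<noteq> B"
  shows "\<exists>C. corners t = {A, B, C} \<and> (A, B, C) \<in> dep_triples n"
proof -
  obtain X Y Z where t: "t = (X, Y, Z)" by (metis prod_cases3)
  have d: "(X, Y, Z) \<in> dep_triples n" "(Y, X, Z) \<in> dep_triples n" "(X, Z, Y) \<in> dep_triples n"
    "(Z, X, Y) \<in> dep_triples n" "(Y, Z, X) \<in> dep_triples n" "(Z, Y, X) \<in> dep_triples n"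
    using assms(1) dep_triples_perm unfolding t by metis+
  consider "A = X" "B = Y" | "A = Y" "B = X" | "A = X" "B = Z" | "A = Z" "B = X"
    | "A = Y" "B = Z" | "A = Z" "B = Y"
    using assms(2-4) unfolding t by auto
  then show ?thesis unfolding t corners_simp using d by cases blast+
qed

text \<open>With all three coefficients nonzero, no coordinate can occur in just one of the forms,
  so each of the three index pairs lies in the union of the other two. Hence the symmetric
  difference of the first two lies in the third; both have two elements once the commuting cases are
  excluded.\<close>

lemma dep_triples_ends:
  assumes "(H1, H2, H3) \<in> dep_triples n"
  shows "\<not> commuting H1 H2"
    and "ends H3 = (ends H1 - ends H2) \<union> (ends H2 - ends H1)"
proof -
  have H: "H1 \<in> Hyp n" "H2 \<in> Hyp n" "H3 \<in> Hyp n" "H1 \<noteq> H2" "H1 \<noteq> H3" "H2 \<noteq> H3"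
    using assms by (auto simp: dep_triples_def)
  obtain c1 c2 c3 where nz: "c1 \<noteq> 0" "c2 \<noteq> 0" "c3 \<noteq> 0"
    and c: "\<And>m. c1 * form H1 m + c2 * form H2 m + c3 * form H3 m = 0"
    by (rule dep_triples_coeffs[OF assms]) blast
  have m: "ends H1 \<subseteq> ends H2 \<union> ends H3" "ends H2 \<subseteq> ends H1 \<union> ends H3" "ends H3 \<subseteq> ends H1 \<union> ends H2"
    using c nz form_eq_0_iff by (metis (no_types, lifting) UnCI add_0 add_0_right mult_eq_0_iff subsetI)+
  have fin: "finite (ends H)" for H by (simp add: ends_def split: prod.splits)
  have eq: "ends A = ends B" if "A \<in> Hyp n" "B \<in> Hyp n" "ends A \<subseteq> ends B" for A B
    using that card_ends by (intro card_subset_eq fin) auto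
  \<comment> \<open>Signs are Boolean, so three distinct hyperplanes cannot share one index
    pair.\<close>
  have two: "ends H1 \<noteq> ends H2 \<or> ends H2 \<noteq> ends H3"
    using H by (cases H1; cases H2; cases H3) (auto simp: Hyp_def doubleton_eq_iff)
  have ne: "ends H \<noteq> {}" for H by (simp add: ends_def split: prod.splits)
  show nc: "\<not> commuting H1 H2"
  proof
    assume "commuting H1 H2"
    then consider "ends H1 = ends H2" | "ends H1 \<inter> ends H2 = {}" unfolding commuting_def by blast
    then show False
    proof cases
      case 1
      then have "ends H3 \<subseteq> ends H1" using m by blast
      then show False using two 1 eq[OF H(3,1)] by blast
    next
      case 2
      then have "ends H1 \<subseteq> ends H3" "ends H2 \<subseteq> ends H3" using m by blast+
      then have "ends H1 = ends H2" using eq H by metis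
      then show False using 2 ne by blast
    qed
  qed
  let ?S = "(ends H1 - ends H2) \<union> (ends H2 - ends H1)"
  have sub: "?S \<subseteq> ends H3" using m by blast
  have "card (ends H1 - ends H2) \<ge> 1" "card (ends H2 - ends H1) \<ge> 1"
    using nc eq[OF H(1,2)] eq[OF H(2,1)] fin unfolding commuting_def
    by (auto simp: Suc_le_eq card_gt_0_iff)
  moreover have "card ?S = card (ends H1 - ends H2) + card (ends H2 - ends H1)"
    using fin by (intro card_Un_disjoint) auto
  ultimately have "card ?S \<ge> 2" by linarith
  then have "?S = ends H3"
    using sub card_ends[OF H(3)] card_mono[OF fin sub] by (intro card_subset_eq[OF fin]) auto
  then show "ends H3 = ?S" by simp
qed

text \<open>This bounds rank-two flats by three elements. Eliminating the form of \<open>H1\<close>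
  from the two dependencies leaves a relation between \<open>H2\<close>, \<open>H3\<close> and
  \<open>L\<close>. At the index \<open>p\<close> shared by \<open>H1\<close> and \<open>H2\<close>
  only the form of \<open>H2\<close> survives, so its coefficient is zero, and \<open>H3\<close>,
  \<open>L\<close> would be distinct with dependent forms.\<close>

lemma dep_triples_unique:
  assumes "(H1, H2, H3) \<in> dep_triples n" "(H1, H2, L) \<in> dep_triples n"
  shows "H3 = L"
proof (rule ccontr)
  assume "H3 \<noteq> L"
  obtain c1 c2 c3 where nz: "c1 \<noteq> 0" "c2 \<noteq> 0" "c3 \<noteq> 0"
    and c: "\<And>m. c1 * form H1 m + c2 * form H2 m + c3 * form H3 m = 0"
    by (rule dep_triples_coeffs[OF assms(1)]) blast
  obtain d1 d2 d3 where nz': "d1 \<noteq> 0" "d2 \<noteq> 0" "d3 \<noteq> 0"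
    and d: "\<And>m. d1 * form H1 m + d2 * form H2 m + d3 * form L m = 0"
    by (rule dep_triples_coeffs[OF assms(2)]) blast
  have comb: "(d1 * c2 - c1 * d2) * form H2 m + d1 * c3 * form H3 m + (- c1 * d3) * form L m = 0" for m
  proof -
    have "d1 * (c1 * form H1 m + c2 * form H2 m + c3 * form H3 m)
      - c1 * (d1 * form H1 m + d2 * form H2 m + d3 * form L m) = 0" using c d by simp
    then show ?thesis by (simp add: algebra_simps)
  qed
  obtain p where p: "p \<in> ends H1" "p \<in> ends H2"
    using dep_triples_ends(1)[OF assms(1)] unfolding commuting_def by blast
  then have "p \<notin> ends H3" "p \<notin> ends L"
    using dep_triples_ends(2)[OF assms(1)] dep_triples_ends(2)[OF assms(2)] by auto
  then have "form H3 p = 0" "form L p = 0" "form H2 p \<noteq> 0"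
    using p(2) form_eq_0_iff by blast+
  then have z: "d1 * c2 - c1 * d2 = 0" using comb[of p] by simp
  have "d1 * c3 * form H3 m + (- c1 * d3) * form L m = 0" for m
    using comb[of m] unfolding z by simp
  moreover have "H3 \<in> Hyp n" "L \<in> Hyp n" using assms by (auto simp: dep_triples_def)
  ultimately have "d1 * c3 = 0" using form_independent2(1) \<open>H3 \<noteq> L\<close> by blast
  then show False using nz nz' by simp
qed

lemma triangles_subset_dep_triples: "triangles n \<subseteq> dep_triples n"
proof
  fix t assume "t \<in> triangles n"
  then obtain i j k a b where ijk: "1 \<le> i" "i < j" "j < k" "k \<le> n"
    and t: "t = ((i, j, a), (j, k, b), (i, k, a \<noteq> b))" unfolding triangles_def by blast
  \<comment> \<open>\<open>?c\<close> is the coefficient of the form of \<open>(i, j, a)\<close> at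
    \<open>j\<close>. Subtracting \<open>?c\<close> times the form of \<open>(j, k, b)\<close>
    clears that coordinate; the coefficient left at \<open>k\<close> is minus the product of the two
    signs, which is the sign encoded by \<open>a \<noteq> b\<close>.\<close>
  let ?c = "if a then 1 else -1 :: complex"
  have "1 * form (i, j, a) m + (- ?c) * form (j, k, b) m + (-1) * form (i, k, a \<noteq> b) m = 0" for m
    using ijk by (auto simp: form_def)
  moreover have "(1, - ?c, -1) \<noteq> (0, 0, 0 :: complex)" by simp
  ultimately have "dependent3 (i, j, a) (j, k, b) (i, k, a \<noteq> b)"
    unfolding dependent3_def by blast
  then show "t \<in> dep_triples n" using ijk by (auto simp: t dep_triples_def Hyp_def)
qed

lemma triangle_through:
  assumes "x \<in> Hyp n" "y \<in> Hyp n" "\<not> commuting x y"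
  shows "\<exists>t\<in>triangles n. x \<in> corners t \<and> y \<in> corners t"
proof -
  have sym: "\<exists>i j k a b. 1 \<le> i \<and> i < j \<and> j < k \<and> k \<le> n \<and>
      x \<in> {(i, j, a), (j, k, b), (i, k, a \<noteq> b)} \<and> y \<in> {(i, j, a), (j, k, b), (i, k, a \<noteq> b)}"
  proof -
    obtain i j s i' j' s' where xy: "x = (i, j, s)" "y = (i', j', s')" by (metis prod_cases3)
    have lt: "1 \<le> i" "i < j" "j \<le> n" "1 \<le> i'" "i' < j'" "j' \<le> n"
      using assms(1,2) by (auto simp: xy Hyp_def)
    \<comment> \<open>The cases are the possible positions of the shared index. Any two signs of a
      triangle determine the third by exclusive or, so the missing side gets the sign
      \<open>s \<noteq> s'\<close> or is determined by the pattern of the triangle.\<close>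
    consider "i = i'" "j < j'" | "i = i'" "j' < j" | "j = j'" "i < i'" | "j = j'" "i' < i"
      | "j = i'" | "j' = i"
      using assms(3) lt unfolding xy commuting_def by (auto simp: doubleton_eq_iff) (metis linorder_neqE_nat)+
    then show ?thesis
    proof cases
      case 1 then show ?thesis using lt unfolding xy
        by (intro exI[of _ i] exI[of _ j] exI[of _ j'] exI[of _ s] exI[of _ "s \<noteq> s'"]) auto
    next
      case 2 then show ?thesis using lt unfolding xy
        by (intro exI[of _ i] exI[of _ j'] exI[of _ j] exI[of _ s'] exI[of _ "s \<noteq> s'"]) auto
    next
      case 3 then show ?thesis using lt unfolding xy
        by (intro exI[of _ i] exI[of _ i'] exI[of _ j] exI[of _ "s \<noteq> s'"] exI[of _ s']) auto
    next
      case 4 then show ?thesis using lt unfolding xy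
        by (intro exI[of _ i'] exI[of _ i] exI[of _ j] exI[of _ "s \<noteq> s'"] exI[of _ s]) auto
    next
      case 5 then show ?thesis using lt unfolding xy
        by (intro exI[of _ i] exI[of _ j] exI[of _ j'] exI[of _ s] exI[of _ s']) auto
    next
      case 6 then show ?thesis using lt unfolding xy
        by (intro exI[of _ i'] exI[of _ i] exI[of _ j] exI[of _ s'] exI[of _ s]) auto
    qed
  qed
  then obtain i j k a b where "1 \<le> i" "i < j" "j < k" "k \<le> n"
      "x \<in> {(i, j, a), (j, k, b), (i, k, a \<noteq> b)}" "y \<in> {(i, j, a), (j, k, b), (i, k, a \<noteq> b)}"
    by blast
  then show ?thesis
    by (intro bexI[of _ "((i, j, a), (j, k, b), (i, k, a \<noteq> b))"]) (auto simp: triangles_def)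
qed

text \<open>The ideal is generated by dependent triples in every order; this reduces them to one
  representative for each flat. The first two hyperplanes do not commute, hence lie in a triangle,
  and the third corner is forced by \<open>dep_triples_unique\<close>.\<close>

lemma dep_triples_triangle:
  assumes "t \<in> dep_triples n"
  shows "\<exists>t'\<in>triangles n. corners t = corners t'"
proof -
  obtain H1 H2 H3 where t: "t = (H1, H2, H3)" by (metis prod_cases3)
  have H: "H1 \<in> Hyp n" "H2 \<in> Hyp n" "H1 \<noteq> H2" using assms by (auto simp: t dep_triples_def)
  obtain t' where t': "t' \<in> triangles n" "H1 \<in> corners t'" "H2 \<in> corners t'"
    using triangle_through[OF H(1,2) dep_triples_ends(1)] assms unfolding t by blast
  then obtain L where L: "corners t' = {H1, H2, L}" "(H1, H2, L) \<in> dep_triples n"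
    using dep_triples_through triangles_subset_dep_triples H(3) by blast
  then have "L = H3" using dep_triples_unique assms unfolding t by blast
  then show ?thesis using t' L unfolding t by auto
qed

lemma sorted3_eq:
  fixes i j k :: nat
  assumes "{i, j, k} = {i', j', k'}" "i < j" "j < k" "i' < j'" "j' < k'"
  shows "i' = i \<and> j' = j \<and> k' = k"
proof -
  have "sorted_list_of_set (set [i, j, k]) = [i, j, k]"
    "sorted_list_of_set (set [i', j', k']) = [i', j', k']"
    using assms(2-5) by (intro sorted_list_of_set.idem_if_sorted_distinct; simp)+
  then show ?thesis using assms(1) by simp
qed

lemma triangles_inj:
  assumes "t \<in> triangles n" "t' \<in> triangles n" "corners t = corners t'"
  shows "t = t'"
proof -
  obtain i j k a b where t: "t = ((i, j, a), (j, k, b), (i, k, a \<noteq> b))" and lt: "i < j" "j < k"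
    using assms(1) unfolding triangles_def by blast
  obtain i' j' k' a' b' where t': "t' = ((i', j', a'), (j', k', b'), (i', k', a' \<noteq> b'))"
    and lt': "i' < j'" "j' < k'"
    using assms(2) unfolding triangles_def by blast
  have "\<Union>(ends ` corners t) = {i, j, k}" "\<Union>(ends ` corners t') = {i', j', k'}"
    unfolding t t' by auto
  then have "i' = i \<and> j' = j \<and> k' = k" using sorted3_eq assms(3) lt lt' by metis
  then have eq: "i' = i" "j' = j" "k' = k" by simp_all
  have "(i, j, a) \<in> corners t'" "(j, k, b) \<in> corners t'" unfolding assms(3)[symmetric] t by simp_all
  then have "a = a'" "b = b'" using lt unfolding t' eq by simp_all
  then show ?thesis unfolding t t' eq by simp
qed

text \<open>Two distinct triangles share at most one corner. Consequently only one generator of the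
  ideal can contribute at a given pair of distinct hyperplanes, which decouples the
  equations.\<close>

lemma triangle_unique:
  assumes "t \<in> triangles n" "t' \<in> triangles n" "x \<noteq> y" "x \<in> corners t" "y \<in> corners t"
    "x \<in> corners t'" "y \<in> corners t'"
  shows "t = t'"
proof (rule triangles_inj[OF assms(1,2)])
  obtain z where z: "corners t = {x, y, z}" "(x, y, z) \<in> dep_triples n"
    using dep_triples_through assms(1,3-5) triangles_subset_dep_triples by blast
  obtain z' where z': "corners t' = {x, y, z'}" "(x, y, z') \<in> dep_triples n"
    using dep_triples_through assms(2,3,6,7) triangles_subset_dep_triples by blast
  show "corners t = corners t'" using z z' dep_triples_unique by blast
qed

lemma triangle_corners:
  assumes "t \<in> triangles n"
  shows "corners t \<subseteq> Hyp n"
    and "x \<in> corners t \<Longrightarrow> y \<in> corners t \<Longrightarrow> commuting x y \<Longrightarrow> x = y"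
    and "t = (H, K, L) \<Longrightarrow> H \<noteq> K \<and> K \<noteq> L \<and> L \<noteq> H"
proof -
  have t: "t \<in> dep_triples n" using assms triangles_subset_dep_triples by blast
  then show "corners t \<subseteq> Hyp n" by (auto simp: dep_triples_def)
  show "t = (H, K, L) \<Longrightarrow> H \<noteq> K \<and> K \<noteq> L \<and> L \<noteq> H" using t by (auto simp: dep_triples_def)
  show "x \<in> corners t \<Longrightarrow> y \<in> corners t \<Longrightarrow> commuting x y \<Longrightarrow> x = y"
    using dep_triples_through[OF t] dep_triples_ends(1) by blast
qed

text \<open>Linear equations of the degree-two part of the Orlik--Solomon ideal. They can be read off flat by
  flat since every rank-two flat of \<open>D\<^sub>n\<close> has two elements (a commuting pair) or three (a triangle).\<close>

definition flat_relations :: "nat \<Rightarrow> (hyp \<times> hyp \<Rightarrow> 'k::comm_ring_1) \<Rightarrow> bool" where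
  "flat_relations n \<omega> \<longleftrightarrow>
     (\<forall>x y. \<omega> (y, x) = - \<omega> (x, y)) \<and>
     (\<forall>x y. commuting x y \<longrightarrow> \<omega> (x, y) = 0) \<and>
     (\<forall>x y. x \<notin> Hyp n \<or> y \<notin> Hyp n \<longrightarrow> \<omega> (x, y) = 0) \<and>
     (\<forall>H K L. (H, K, L) \<in> triangles n \<longrightarrow> \<omega> (H, K) = \<omega> (K, L) \<and> \<omega> (K, L) = \<omega> (L, H))"

lemma flat_relationsI:
  assumes "\<And>x y. \<omega> (y, x) = - \<omega> (x, y)" "\<And>x y. commuting x y \<Longrightarrow> \<omega> (x, y) = 0"
    "\<And>x y. x \<notin> Hyp n \<or> y \<notin> Hyp n \<Longrightarrow> \<omega> (x, y) = 0"
    "\<And>H K L. (H, K, L) \<in> triangles n \<Longrightarrow> \<omega> (H, K) = \<omega> (K, L) \<and> \<omega> (K, L) = \<omega> (L, H)"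
  shows "flat_relations n \<omega>"
  unfolding flat_relations_def
  by (intro conjI allI impI; rule assms conjunct1[OF assms(4)] conjunct2[OF assms(4)]; assumption?)

lemma flat_relationsD:
  assumes "flat_relations n \<omega>"
  shows "\<omega> (y, x) = - \<omega> (x, y)"
    and "commuting x y \<Longrightarrow> \<omega> (x, y) = 0"
    and "x \<notin> Hyp n \<or> y \<notin> Hyp n \<Longrightarrow> \<omega> (x, y) = 0"
    and "(H, K, L) \<in> triangles n \<Longrightarrow> \<omega> (H, K) = \<omega> (K, L)"
    and "(H, K, L) \<in> triangles n \<Longrightarrow> \<omega> (K, L) = \<omega> (L, H)"
  using assms unfolding flat_relations_def by blast+

text \<open>Replacing \<open>- e2 H L\<close> by \<open>e2 L H\<close> makes the boundary a sum over
  the cyclic pairs, so it takes the value 1 along the cycle and -1 against it.\<close>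

lemma bd3_apply:
  assumes "H \<noteq> K" "K \<noteq> L" "L \<noteq> H"
  shows "bd3 (H, K, L) (x, y) = (if (x, y) \<in> {(H, K), (K, L), (L, H)} then 1
    else if (y, x) \<in> {(H, K), (K, L), (L, H)} then -1 else 0)"
  unfolding bd3_def e2_def using assms
  by (cases "x = H"; cases "x = K"; cases "x = L"; simp; auto)

lemma bd3_eq_0_outside:
  assumes "t \<in> triangles n" "x \<notin> corners t \<or> y \<notin> corners t \<or> x = y"
  shows "bd3 t (x, y) = 0"
proof -
  obtain H K L where t: "t = (H, K, L)" by (metis prod_cases3)
  have ne: "H \<noteq> K" "K \<noteq> L" "L \<noteq> H" using triangle_corners(3)[OF assms(1) t] by auto
  show ?thesis using assms(2) ne unfolding t bd3_apply[OF ne] by auto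
qed

lemma flat_relations_bd3_triangle:
  assumes "t \<in> triangles n"
  shows "flat_relations n (bd3 t :: hyp \<times> hyp \<Rightarrow> 'k::comm_ring_1)"
proof -
  define \<beta> :: "hyp \<times> hyp \<Rightarrow> 'k" where "\<beta> = bd3 t"
  obtain H K L where t: "t = (H, K, L)" by (metis prod_cases3)
  have ne: "H \<noteq> K" "K \<noteq> L" "L \<noteq> H" using triangle_corners(3)[OF assms t] by auto
  have out: "\<beta> (x, y) = 0" if "x \<notin> corners t \<or> y \<notin> corners t \<or> x = y" for x y
    unfolding \<beta>_def by (rule bd3_eq_0_outside[OF assms that])
  have comm: "\<beta> (x, y) = 0" if "commuting x y" for x y
    using out triangle_corners(2)[OF assms] that by blast
  have hyp: "\<beta> (x, y) = 0" if "x \<notin> Hyp n \<or> y \<notin> Hyp n" for x y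
    using out triangle_corners(1)[OF assms] that by blast
  have alt: "\<beta> (y, x) = - \<beta> (x, y)" for x y
    using ne unfolding \<beta>_def t bd3_apply[OF ne] by auto
  have tri: "\<beta> (H', K') = \<beta> (K', L') \<and> \<beta> (K', L') = \<beta> (L', H')"
    if t': "(H', K', L') \<in> triangles n" for H' K' L'
  proof (cases "t = (H', K', L')")
    case True
    then have "H' = H" "K' = K" "L' = L" using t by simp_all
    then show ?thesis unfolding \<beta>_def t bd3_apply[OF ne] by simp
  next
    case False
    \<comment> \<open>Two distinct corners of another triangle cannot both be corners of
      \<open>t\<close>, and \<open>\<beta>\<close> vanishes on the diagonal anyway.\<close>
    then have "\<beta> (x, y) = 0" if "x \<in> corners (H', K', L')" "y \<in> corners (H', K', L')" for x y
      using triangle_unique[OF assms t', of x y] out[of x y] that by blast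
    then have "\<beta> (H', K') = 0" "\<beta> (K', L') = 0" "\<beta> (L', H') = 0" by simp_all
    then show ?thesis by simp
  qed
  show ?thesis unfolding \<beta>_def[symmetric] by (rule flat_relationsI) (fact alt comm hyp tri)+
qed

lemma flat_relations_scale:
  assumes fl: "flat_relations n \<omega>"
  shows "flat_relations n (\<lambda>p. c * \<omega> p)"
proof (rule flat_relationsI)
  show "c * \<omega> (y, x) = - (c * \<omega> (x, y))" for x y by (subst flat_relationsD(1)[OF fl]) simp
  show "c * \<omega> (x, y) = 0" if "commuting x y" for x y
    by (simp only: flat_relationsD(2)[OF fl that] mult_zero_right)
  show "c * \<omega> (x, y) = 0" if "x \<notin> Hyp n \<or> y \<notin> Hyp n" for x y
    by (simp only: flat_relationsD(3)[OF fl that] mult_zero_right)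
  show "c * \<omega> (H, K) = c * \<omega> (K, L) \<and> c * \<omega> (K, L) = c * \<omega> (L, H)"
    if "(H, K, L) \<in> triangles n" for H K L
    by (simp only: flat_relationsD(4,5)[OF fl that])
qed

lemma flat_relations_sum:
  assumes "\<And>t. t \<in> T \<Longrightarrow> flat_relations n (\<omega> t)"
  shows "flat_relations n (\<lambda>p. \<Sum>t\<in>T. \<omega> t p)"
proof (rule flat_relationsI)
  fix x y
  have "(\<Sum>t\<in>T. \<omega> t (y, x)) = (\<Sum>t\<in>T. - \<omega> t (x, y))"
    by (intro sum.cong refl flat_relationsD(1)[of n] assms)
  then show "(\<Sum>t\<in>T. \<omega> t (y, x)) = - (\<Sum>t\<in>T. \<omega> t (x, y))" by (simp add: sum_negf)
next
  fix x y assume "commuting x y"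
  then show "(\<Sum>t\<in>T. \<omega> t (x, y)) = 0"
    by (intro sum.neutral ballI flat_relationsD(2)[of n] assms)
next
  fix x y assume "x \<notin> Hyp n \<or> y \<notin> Hyp n"
  then show "(\<Sum>t\<in>T. \<omega> t (x, y)) = 0"
    by (intro sum.neutral ballI flat_relationsD(3)[of n] assms)
next
  fix H K L assume "(H, K, L) \<in> triangles n"
  then show "(\<Sum>t\<in>T. \<omega> t (H, K)) = (\<Sum>t\<in>T. \<omega> t (K, L))
      \<and> (\<Sum>t\<in>T. \<omega> t (K, L)) = (\<Sum>t\<in>T. \<omega> t (L, H))"
    by (intro conjI sum.cong refl flat_relationsD(4,5)[of n] assms)
qed

lemma e2_swap: "H \<noteq> K \<Longrightarrow> e2 K H p = - e2 H K p"
  by (cases p) (simp add: e2_def)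

text \<open>The boundary is alternating in its three entries, so each ordering of a triangle gives
  the generator of that triangle up to sign.\<close>

lemma flat_relations_bd3:
  assumes "t \<in> dep_triples n"
  shows "flat_relations n (bd3 t :: hyp \<times> hyp \<Rightarrow> 'k::comm_ring_1)"
proof -
  obtain H1 H2 H3 where t: "t = (H1, H2, H3)" by (metis prod_cases3)
  obtain D1 D2 D3 where D: "(D1, D2, D3) \<in> triangles n" "{H1, H2, H3} = {D1, D2, D3}"
    using dep_triples_triangle[OF assms] unfolding t by auto
  have ne: "H1 \<noteq> H2" "H2 \<noteq> H3" "H3 \<noteq> H1" using assms by (auto simp: t dep_triples_def)
  have ne': "D1 \<noteq> D2" "D2 \<noteq> D3" "D3 \<noteq> D1" using triangle_corners(3)[OF D(1) refl] by auto
  have mem: "H1 = D1 \<or> H1 = D2 \<or> H1 = D3" "H2 = D1 \<or> H2 = D2 \<or> H2 = D3"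
    "H3 = D1 \<or> H3 = D2 \<or> H3 = D3"
    using D(2) by (metis insertCI insertE singletonD)+
  note swap = e2_swap[OF ne'(1)] e2_swap[OF ne'(2)] e2_swap[OF ne'(3)]
  consider "H1 = D1" "H2 = D2" "H3 = D3" | "H1 = D2" "H2 = D3" "H3 = D1"
    | "H1 = D3" "H2 = D1" "H3 = D2" | "H1 = D2" "H2 = D1" "H3 = D3"
    | "H1 = D1" "H2 = D3" "H3 = D2" | "H1 = D3" "H2 = D2" "H3 = D1"
    using mem ne by metis
  then have "bd3 t = (\<lambda>p. 1 * bd3 (D1, D2, D3) p :: 'k) \<or> bd3 t = (\<lambda>p. (-1) * bd3 (D1, D2, D3) p :: 'k)"
  proof cases
    case 1 then show ?thesis unfolding t by simp
  next
    case 2 then show ?thesis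
      unfolding t by (simp add: bd3_def fun_eq_iff swap del: split_paired_All)
  next
    case 3 then show ?thesis
      unfolding t by (simp add: bd3_def fun_eq_iff swap del: split_paired_All)
  next
    case 4 then show ?thesis
      unfolding t by (simp add: bd3_def fun_eq_iff swap del: split_paired_All)
  next
    case 5 then show ?thesis
      unfolding t by (simp add: bd3_def fun_eq_iff swap del: split_paired_All)
  next
    case 6 then show ?thesis
      unfolding t by (simp add: bd3_def fun_eq_iff swap del: split_paired_All)
  qed
  then show ?thesis
    using flat_relations_scale[OF flat_relations_bd3_triangle[OF D(1)]] by metis
qed

lemma finite_triangles: "finite (triangles n)"
proof (rule finite_subset)
  show "triangles n \<subseteq> Hyp n \<times> Hyp n \<times> Hyp n" by (auto simp: triangles_def Hyp_def)
qed (simp add: finite_Hyp)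

lemma OS_ideal2_iff: "\<omega> \<in> OS_ideal2 n \<longleftrightarrow> flat_relations n \<omega>"
proof
  assume "\<omega> \<in> OS_ideal2 n"
  then obtain T c where "T \<subseteq> dep_triples n" "\<omega> = (\<lambda>p. \<Sum>t\<in>T. c t * bd3 t p)"
    unfolding OS_ideal2_def by blast
  then show "flat_relations n \<omega>"
    by (auto intro!: flat_relations_sum flat_relations_scale flat_relations_bd3)
next
  assume fl: "flat_relations n \<omega>"
  \<comment> \<open>The coefficient is forced: the generator of a triangle has value 1 at its first
    two corners, and no other triangle contributes there.\<close>
  let ?c = "\<lambda>t. \<omega> (fst t, fst (snd t))"
  have "\<omega> p = (\<Sum>t\<in>triangles n. ?c t * bd3 t p)" for p
  proof -
    obtain x y where p: "p = (x, y)" by (metis prod.exhaust)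
    show ?thesis
    proof (cases "x \<in> Hyp n \<and> y \<in> Hyp n \<and> \<not> commuting x y")
      case False
      \<comment> \<open>Applied to \<open>\<omega>\<close> as well as to each generator, so both
        sides of the expansion vanish at such a pair.\<close>
      have zero: "\<eta> (x, y) = 0" if fl: "flat_relations n \<eta>" for \<eta> :: "hyp \<times> hyp \<Rightarrow> 'a"
      proof (cases "commuting x y")
        case True
        then show ?thesis by (rule flat_relationsD(2)[OF fl])
      next
        case False
        then have "x \<notin> Hyp n \<or> y \<notin> Hyp n" using \<open>\<not> (x \<in> Hyp n \<and> y \<in> Hyp n \<and> \<not> commuting x y)\<close> by blast
        then show ?thesis by (rule flat_relationsD(3)[OF fl])
      qed
      have "bd3 t (x, y) = (0 :: 'a)" if "t \<in> triangles n" for t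
        by (rule zero[OF flat_relations_bd3_triangle[OF that]])
      moreover have "\<omega> p = 0" unfolding p by (rule zero[OF fl])
      ultimately show ?thesis by (simp add: p)
    next
      case True
      then have "x \<noteq> y" by (auto simp: commuting_def)
      obtain t where t: "t \<in> triangles n" "x \<in> corners t" "y \<in> corners t"
        using triangle_through True by blast
      have "(\<Sum>t\<in>triangles n. ?c t * bd3 t p) = (\<Sum>t\<in>{t}. ?c t * bd3 t p)"
      proof (rule sum.mono_neutral_right)
        show "\<forall>s\<in>triangles n - {t}. ?c s * bd3 s p = 0"
        proof
          fix s assume s: "s \<in> triangles n - {t}"
          then have "x \<notin> corners s \<or> y \<notin> corners s"
            using triangle_unique[OF t(1) _ \<open>x \<noteq> y\<close> t(2,3)] by blast
          then have "bd3 s (x, y) = (0 :: 'a)" using bd3_eq_0_outside s by blast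
          then show "?c s * bd3 s p = 0" unfolding p by simp
        qed
      qed (use t(1) finite_triangles in auto)
      moreover obtain H K L where HKL: "t = (H, K, L)" by (metis prod_cases3)
      have ne: "H \<noteq> K" "K \<noteq> L" "L \<noteq> H" using triangle_corners(3)[OF t(1) HKL] by auto
      note cyc = flat_relationsD(4)[OF fl t(1)[unfolded HKL]] flat_relationsD(5)[OF fl t(1)[unfolded HKL]]
      have eq: "\<omega> (K, L) = \<omega> (H, K)" "\<omega> (L, H) = \<omega> (H, K)" by (simp_all only: cyc)
      note alt = flat_relationsD(1)[OF fl]
      have alt: "\<omega> (K, H) = - \<omega> (H, K)" "\<omega> (L, K) = - \<omega> (H, K)" "\<omega> (H, L) = - \<omega> (H, K)"
        using alt[of K H] alt[of L K] alt[of H L] unfolding eq by simp_all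
      consider "x = H" "y = K" | "x = K" "y = L" | "x = L" "y = H"
        | "x = K" "y = H" | "x = L" "y = K" | "x = H" "y = L"
        using t(2,3) \<open>x \<noteq> y\<close> unfolding HKL corners_simp by (elim insertE emptyE) simp_all
      then have "\<omega> p = ?c t * bd3 t p"
        unfolding p HKL bd3_apply[OF ne]
        by cases (use ne ne[symmetric] in \<open>simp_all add: eq alt\<close>)
      ultimately show ?thesis by simp
    qed
  qed
  then have "\<omega> = (\<lambda>p. \<Sum>t\<in>triangles n. ?c t * bd3 t p)" by (rule ext)
  then show "\<omega> \<in> OS_ideal2 n"
    unfolding OS_ideal2_def
    by (intro CollectI exI[of _ "triangles n"] exI[of _ ?c] conjI finite_triangles triangles_subset_dep_triples)
qed

subsection \<open>Resonant pairs of weights\<close>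

text \<open>The plane determinant. Its value on \<open>(a x, b x)\<close> and
  \<open>(a y, b y)\<close> is \<open>wedge a b (x, y)\<close>, which turns the flat relations into
  statements about plane vectors.\<close>

definition cross2 :: "'k::field \<times> 'k \<Rightarrow> 'k \<times> 'k \<Rightarrow> 'k" where
  "cross2 u v = fst u * snd v - fst v * snd u"

definition scale2 :: "'k::field \<Rightarrow> 'k \<times> 'k \<Rightarrow> 'k \<times> 'k" where
  "scale2 c u = (c * fst u, c * snd u)"

lemma cross2_scale2 [simp]: "cross2 (scale2 c u) v = c * cross2 u v" "cross2 u (scale2 c v) = c * cross2 u v"
  by (simp_all add: cross2_def scale2_def algebra_simps)

lemma fst_scale2 [simp]: "fst (scale2 c u) = c * fst u"
  by (simp add: scale2_def)

lemma cross2_swap: "cross2 v u = - cross2 u v"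
  by (simp add: cross2_def)

lemma scale2_one [simp]: "scale2 1 u = u"
  by (simp add: scale2_def)

text \<open>The second hypothesis is a convenient way to say that \<open>u\<close> is nonzero;
  \<open>c\<close> is the quotient of the coordinates at which \<open>u\<close> does not
  vanish.\<close>

lemma cross2_parallel:
  assumes "cross2 v u = 0" "cross2 u w \<noteq> 0"
  shows "\<exists>c. v = scale2 c u"
proof (cases "fst u = 0")
  case True
  then have "snd u \<noteq> 0" using assms(2) by (auto simp: cross2_def)
  moreover from this have "fst v = 0" using True assms(1) by (simp add: cross2_def)
  ultimately show ?thesis
    using True by (intro exI[of _ "snd v / snd u"]) (simp add: scale2_def prod_eq_iff)
next
  case False
  then show ?thesis
    using assms(1) by (intro exI[of _ "fst v / fst u"]) (simp add: scale2_def cross2_def prod_eq_iff field_simps)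
qed

lemma cross2_both_zero:
  assumes "cross2 v u = 0" "cross2 v w = 0" "cross2 u w \<noteq> 0"
  shows "v = (0, 0)"
proof -
  obtain c where v: "v = scale2 c u" using cross2_parallel[OF assms(1,3)] by blast
  then have "c = 0" using assms(2,3) by simp
  then show ?thesis by (simp add: v scale2_def)
qed

text \<open>The determinants of the sum vector with \<open>u\<close> and with \<open>v\<close> are
  differences of equal terms, and a vector parallel to both of the independent \<open>u\<close>,
  \<open>v\<close> is zero.\<close>

lemma cross2_cyclic_sum:
  assumes "cross2 u v = cross2 v w" "cross2 v w = cross2 w u" "cross2 u v \<noteq> 0"
  shows "fst u + fst v + fst w = 0"
proof -
  let ?s = "(fst u + fst v + fst w, snd u + snd v + snd w)"
  have "cross2 ?s u = cross2 w u - cross2 u v" "cross2 ?s v = cross2 u v - cross2 v w"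
    by (simp_all add: cross2_def algebra_simps)
  then have "?s = (0, 0)" using assms by (intro cross2_both_zero[of ?s u v]) auto
  then show ?thesis by simp
qed

text \<open>The shape of a resonant weight, written in terms of unordered index pairs; the sign vector \<open>\<eta>\<close>
  makes \<open>S\<close> the image of a braid arrangement, and \<open>full\<close> means that both signs occur.\<close>

definition structured :: "nat set \<Rightarrow> nat set \<Rightarrow> (nat \<Rightarrow> bool) \<Rightarrow> bool \<Rightarrow> (nat \<Rightarrow> nat \<Rightarrow> bool \<Rightarrow> 'k::field) \<Rightarrow> bool" where
  "structured N S \<eta> full f \<longleftrightarrow>
    (\<forall>p\<in>N. \<forall>q\<in>N. p \<noteq> q \<longrightarrow> (\<forall>s. f p q s =
      (if p \<in> S \<and> q \<in> S \<and> (full \<or> s = (\<eta> p \<noteq> \<eta> q)) then f p q (\<eta> p \<noteq> \<eta> q) else 0))) \<and>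
    (\<forall>p\<in>S. \<forall>q\<in>S. \<forall>r\<in>S. distinct [p, q, r] \<longrightarrow>
      f p q (\<eta> p \<noteq> \<eta> q) + f q r (\<eta> q \<noteq> \<eta> r) + f p r (\<eta> p \<noteq> \<eta> r) = 0) \<and>
    (\<forall>p\<in>S. \<forall>q\<in>S. \<forall>r\<in>S. \<forall>t\<in>S. distinct [p, q, r, t] \<longrightarrow>
      f p q (\<eta> p \<noteq> \<eta> q) = f r t (\<eta> r \<noteq> \<eta> t))"

text \<open>The vector \<open>V p q s\<close> is the pair of values of the two weights at a hyperplane. All vectors outside
  the given triangle are parallel to one of \<open>X\<close>, \<open>Y\<close>, \<open>Z\<close>, and the remaining triangles force the
  factors to be 0 or 1.\<close>

lemma structured_if_triangle:
  fixes V :: "nat \<Rightarrow> nat \<Rightarrow> bool \<Rightarrow> 'k::field \<times> 'k"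
  assumes sym: "\<And>p q s. V p q s = V q p s"
    and same: "\<And>p q s t. p \<in> N \<Longrightarrow> q \<in> N \<Longrightarrow> p \<noteq> q \<Longrightarrow> cross2 (V p q s) (V p q t) = 0"
    and disj: "\<And>p q r u s t. {p, q, r, u} \<subseteq> N \<Longrightarrow> distinct [p, q, r, u] \<Longrightarrow> cross2 (V p q s) (V r u t) = 0"
    and tri: "\<And>p q r s t. {p, q, r} \<subseteq> N \<Longrightarrow> distinct [p, q, r] \<Longrightarrow>
      cross2 (V p q s) (V q r t) = cross2 (V q r t) (V r p (s \<noteq> t))"
    and ijk: "{i, j, k} \<subseteq> N" "distinct [i, j, k]"
    and nz: "cross2 (V i j False) (V j k False) \<noteq> 0"
  shows "\<exists>S \<eta> full. S \<subseteq> N \<and> (card S = 3 \<or> card S = 4) \<and>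
    structured N S \<eta> full (\<lambda>p q s. fst (V p q s))"
proof -
  define X Z Y where "X = V i j False" and "Z = V j k False" and "Y = V i k False"
  define d where "d = cross2 X Z"
  have d: "d \<noteq> 0" using nz by (simp add: d_def X_def Z_def)
  have V: "V i j False = X" "V j i False = X" "V j k False = Z" "V k j False = Z"
    "V i k False = Y" "V k i False = Y"
    using sym by (simp_all add: X_def Y_def Z_def)
  \<comment> \<open>The cyclic order is \<open>X\<close>, \<open>Z\<close>, \<open>Y\<close>, since
    \<open>Z\<close> sits at \<open>{j, k}\<close> and \<open>Y\<close> at \<open>{i, k}\<close>. A
    single nonzero \<open>d\<close> serves as the common determinant of all later
    comparisons.\<close>
  have crs: "cross2 X Z = d" "cross2 Z Y = d" "cross2 Y X = d"
    using tri[of i j k False False] tri[of j k i False False] ijk by (auto simp: V d_def)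
  have crs': "cross2 Z X = - d" "cross2 Y Z = - d" "cross2 X Y = - d"
    using crs cross2_swap by metis+
  have sum0: "fst X + fst Z + fst Y = 0"
    using crs d by (intro cross2_cyclic_sum) auto
  have nz: "cross2 X Z \<noteq> 0" "cross2 Z Y \<noteq> 0" "cross2 Y X \<noteq> 0" using crs d by auto
  have ijk': "i \<in> N" "j \<in> N" "k \<in> N" "i \<noteq> j" "i \<noteq> k" "j \<noteq> k" "j \<noteq> i" "k \<noteq> i" "k \<noteq> j" using ijk by auto

  obtain x where x: "V i j True = scale2 x X"
    using cross2_parallel[OF _ nz(1)] same[of i j True False] ijk' V by metis
  obtain y where y: "V i k True = scale2 y Y"
    using cross2_parallel[OF _ nz(3)] same[of i k True False] ijk' V by metis
  obtain z where z: "V j k True = scale2 z Z"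
    using cross2_parallel[OF _ nz(2)] same[of j k True False] ijk' V by metis
  have T: "V i j True = scale2 x X" "V j i True = scale2 x X" "V j k True = scale2 z Z" "V k j True = scale2 z Z"
    "V i k True = scale2 y Y" "V k i True = scale2 y Y"
    using sym x y z by metis+
  \<comment> \<open>Triple flats have an even number of plus signs. Those on \<open>i\<close>,
    \<open>j\<close>, \<open>k\<close> with two plus signs make the three factors equal, and
    comparing two plus sides with one minus side makes the common factor idempotent.\<close>
  have "x * d = y * d" "y * d = y * x * d"
    using tri[of i j k True False] tri[of j k i False True] ijk by (auto simp: V T crs)
  moreover have "z * d = x * d"
    using tri[of j k i True False] tri[of k i j False True] ijk by (auto simp: V T crs)
  ultimately have xyz: "y = x" "z = x" "x * x = x" using d by auto
  have x01: "x = 0 \<or> x = 1" using xyz(3) by auto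

  \<comment> \<open>A hyperplane through \<open>l\<close> commutes with the opposite side of the
    triangle \<open>i\<close>, \<open>j\<close>, \<open>k\<close>, so its vector is a multiple of
    the vector there. The triangles on \<open>l\<close> and two of the old indices make the three
    multiples equal and idempotent.\<close>
  have "\<exists>m. V i l s = scale2 m Z \<and> V j l s = scale2 m Y \<and> V k l s = scale2 m X \<and> (m = 0 \<or> m = 1)"
    if l: "l \<in> N - {i, j, k}" for l s
  proof -
    obtain p where p: "V i l s = scale2 p Z"
      using cross2_parallel[OF _ nz(2)] disj[of i l j k s False] ijk' l V by fastforce
    obtain q where q: "V j l s = scale2 q Y"
      using cross2_parallel[OF _ nz(3)] disj[of j l i k s False] ijk' l V by fastforce
    obtain r where r: "V k l s = scale2 r X"
      using cross2_parallel[OF _ nz(1)] disj[of k l i j s False] ijk' l V by fastforce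
    have pqr: "V i l s = scale2 p Z" "V l i s = scale2 p Z" "V j l s = scale2 q Y" "V l j s = scale2 q Y"
      "V k l s = scale2 r X" "V l k s = scale2 r X" using sym p q r by metis+
    have "p * d = q * d" "q * d = q * p * d"
      using tri[of l i j s False] tri[of i j l False s] ijk l by (auto simp: V pqr crs crs')
    moreover have "p * d = r * d"
      using tri[of l i k s False] ijk l by (auto simp: V pqr crs crs')
    ultimately have "q = p" "r = p" "p * p = p" using d by auto
    then show ?thesis using pqr by auto
  qed
  then obtain m where m: "\<And>l s. l \<in> N - {i, j, k} \<Longrightarrow>
      V i l s = scale2 (m l s) Z \<and> V j l s = scale2 (m l s) Y \<and> V k l s = scale2 (m l s) X \<and> (m l s = 0 \<or> m l s = 1)"
    by metis
  have m01: "m l s = 0 \<or> m l s = 1" if "l \<in> N - {i, j, k}" for l s using m that by blast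
  have W: "V i l s = scale2 (m l s) Z" "V l i s = scale2 (m l s) Z" "V j l s = scale2 (m l s) Y"
    "V l j s = scale2 (m l s) Y" "V k l s = scale2 (m l s) X" "V l k s = scale2 (m l s) X"
    if "l \<in> N - {i, j, k}" for l s
    using m[OF that] sym by metis+
  \<comment> \<open>The triangle on \<open>l\<close>, \<open>i\<close>, \<open>j\<close> with a plus
    sign at \<open>{i, j}\<close> links the two signs at \<open>l\<close> to \<open>x\<close>. If
    one of the factors \<open>m l True\<close>, \<open>m l False\<close> is 1, the other equals
    \<open>x\<close>; so both signs occur over every index pair of \<open>S\<close> or over
    none.\<close>
  have mix: "x * m l True = x * m l False" "x * m l True = m l False * m l True"
    if l: "l \<in> N - {i, j, k}" for l
  proof -
    have "x * m l True * d = x * m l False * d" "x * m l False * d = m l True * m l False * d"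
      using tri[of l i j True True] tri[of i j l True False] ijk l
      by (auto simp: T W[OF l] crs crs')
    then show "x * m l True = x * m l False" "x * m l True = m l False * m l True" using d by auto
  qed
  \<comment> \<open>The hyperplanes over \<open>{i, l}\<close> and \<open>{j, l'}\<close> commute,
    but their vectors are multiples of the independent \<open>Z\<close> and \<open>Y\<close>. Hence
    at most one index joins \<open>i\<close>, \<open>j\<close>, \<open>k\<close>.\<close>
  have uniq: "m l s * m l' t = 0" if l: "l \<in> N - {i, j, k}" "l' \<in> N - {i, j, k}" "l \<noteq> l'" for l l' s t
  proof -
    have "cross2 (V i l s) (V j l' t) = 0" using l ijk by (intro disj) auto
    then show ?thesis using d by (auto simp: W[OF l(1)] W[OF l(2)] crs)
  qed
  \<comment> \<open>A hyperplane away from \<open>i\<close>, \<open>j\<close>, \<open>k\<close>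
    commutes with the hyperplanes carrying \<open>X\<close> and \<open>Z\<close>, which span the
    plane.\<close>
  have outer: "V p q s = (0, 0)" if "p \<in> N - {i, j, k}" "q \<in> N - {i, j, k}" "p \<noteq> q" for p q s
    using disj[of p q i j s False] disj[of p q j k s False] that ijk nz(1)
    by (intro cross2_both_zero[of _ X Z]) (auto simp: V)

  have structuredI: "structured N S \<eta> (x = 1) (\<lambda>p q s. fst (V p q s))"
    if out: "\<And>p q s. p \<in> N - S \<Longrightarrow> q \<in> N \<Longrightarrow> p \<noteq> q \<Longrightarrow> fst (V p q s) = 0"
      and flip: "\<And>p q. p \<in> S \<Longrightarrow> q \<in> S \<Longrightarrow> p \<noteq> q \<Longrightarrow>
        fst (V p q (\<eta> p = \<eta> q)) = x * fst (V p q (\<eta> p \<noteq> \<eta> q))"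
      and sum: "\<forall>p\<in>S. \<forall>q\<in>S. \<forall>r\<in>S. distinct [p, q, r] \<longrightarrow> fst (V p q (\<eta> p \<noteq> \<eta> q))
        + fst (V q r (\<eta> q \<noteq> \<eta> r)) + fst (V p r (\<eta> p \<noteq> \<eta> r)) = 0"
      and opp: "\<forall>p\<in>S. \<forall>q\<in>S. \<forall>r\<in>S. \<forall>t\<in>S. distinct [p, q, r, t] \<longrightarrow>
        fst (V p q (\<eta> p \<noteq> \<eta> q)) = fst (V r t (\<eta> r \<noteq> \<eta> t))"
    for S \<eta>
    unfolding structured_def
  proof (intro conjI sum opp ballI allI impI)
    fix p q s assume pq: "p \<in> N" "q \<in> N" "p \<noteq> q"
    show "fst (V p q s) = (if p \<in> S \<and> q \<in> S \<and> (x = 1 \<or> s = (\<eta> p \<noteq> \<eta> q))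
      then fst (V p q (\<eta> p \<noteq> \<eta> q)) else 0)"
    proof (cases "p \<in> S \<and> q \<in> S")
      case True
      then show ?thesis using flip[of p q] pq(3) x01
        by (cases "s = (\<eta> p \<noteq> \<eta> q)") auto
    next
      case False
      then have "fst (V p q s) = 0" using out[of p q s] out[of q p s] pq sym[of p q s] by auto
      then show ?thesis using False by auto
    qed
  qed

  show ?thesis
  proof (cases "\<forall>l\<in>N - {i, j, k}. \<forall>s. m l s = 0")
    case True
    have "structured N {i, j, k} (\<lambda>_. False) (x = 1) (\<lambda>p q s. fst (V p q s))"
    proof (rule structuredI)
      fix p q s assume pq: "p \<in> N - {i, j, k}" "q \<in> N" "p \<noteq> q"
      show "fst (V p q s) = 0"
      proof (cases "q \<in> {i, j, k}")
        case True
        then show ?thesis using \<open>\<forall>l\<in>N - {i, j, k}. \<forall>s. m l s = 0\<close> pq(1) by (auto simp: W)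
      qed (use outer pq in simp)
    next
      fix p q assume "p \<in> {i, j, k}" "q \<in> {i, j, k}" "p \<noteq> q"
      then show "fst (V p q (False = False)) = x * fst (V p q (False \<noteq> False))"
        by (auto simp: V T xyz)
    next
      show "\<forall>p\<in>{i, j, k}. \<forall>q\<in>{i, j, k}. \<forall>r\<in>{i, j, k}. distinct [p, q, r] \<longrightarrow>
        fst (V p q (False \<noteq> False)) + fst (V q r (False \<noteq> False)) + fst (V p r (False \<noteq> False)) = 0"
        using sum0 by (simp add: V add_ac)
    qed simp
    moreover have "card {i, j, k} = 3" using ijk by simp
    ultimately show ?thesis using ijk(1) by blast
  next
    case False
    then obtain l s0 where l: "l \<in> N - {i, j, k}" and ms: "m l s0 = 1" using m01 by blast
    have mn: "m l (\<not> s0) = x" using mix[OF l] ms x01 m01[OF l] by (cases s0) auto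
    define S where "S = {i, j, k, l}"
    \<comment> \<open>On \<open>i\<close>, \<open>j\<close>, \<open>k\<close> the signs are already
      normalised to minus. Flipping \<open>l\<close> exactly when \<open>s0\<close> is plus makes
      the hyperplanes with factor 1 those selected by \<open>\<eta>\<close>.\<close>
    define \<eta> where "\<eta> = (\<lambda>p. p = l \<and> s0)"
    have ne: "l \<noteq> i" "l \<noteq> j" "l \<noteq> k" "i \<noteq> l" "j \<noteq> l" "k \<noteq> l" using l by auto
    have \<eta>: "\<eta> i = False" "\<eta> j = False" "\<eta> k = False" "\<eta> l = s0" using ne by (simp_all add: \<eta>_def)
    have W1: "V i l s0 = Z" "V l i s0 = Z" "V j l s0 = Y" "V l j s0 = Y" "V k l s0 = X" "V l k s0 = X"
      by (simp_all add: W[OF l] ms)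
    have W2: "V i l (\<not> s0) = scale2 x Z" "V l i (\<not> s0) = scale2 x Z" "V j l (\<not> s0) = scale2 x Y"
      "V l j (\<not> s0) = scale2 x Y" "V k l (\<not> s0) = scale2 x X" "V l k (\<not> s0) = scale2 x X"
      by (simp_all add: W[OF l] mn)
    have "structured N S \<eta> (x = 1) (\<lambda>p q s. fst (V p q s))"
    proof (rule structuredI)
      fix p q s assume pq: "p \<in> N - S" "q \<in> N" "p \<noteq> q"
      then have p: "p \<in> N - {i, j, k}" "p \<noteq> l" by (auto simp: S_def)
      have "m p s = 0" using uniq[OF p(1) l p(2), of s s0] ms by simp
      then show "fst (V p q s) = 0"
        using outer[OF p(1), of q s] pq by (cases "q \<in> {i, j, k}") (auto simp: W[OF p(1)])
    next
      fix p q assume "p \<in> S" "q \<in> S" "p \<noteq> q"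
      then show "fst (V p q (\<eta> p = \<eta> q)) = x * fst (V p q (\<eta> p \<noteq> \<eta> q))"
        unfolding S_def by (elim insertE emptyE) (simp_all add: \<eta> V T xyz W1 W2)
    next
      show "\<forall>p\<in>S. \<forall>q\<in>S. \<forall>r\<in>S. distinct [p, q, r] \<longrightarrow> fst (V p q (\<eta> p \<noteq> \<eta> q))
        + fst (V q r (\<eta> q \<noteq> \<eta> r)) + fst (V p r (\<eta> p \<noteq> \<eta> r)) = 0"
        using sum0 unfolding S_def by (simp add: \<eta> V W1 add_ac)
    next
      show "\<forall>p\<in>S. \<forall>q\<in>S. \<forall>r\<in>S. \<forall>t\<in>S. distinct [p, q, r, t] \<longrightarrow>
        fst (V p q (\<eta> p \<noteq> \<eta> q)) = fst (V r t (\<eta> r \<noteq> \<eta> t))"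
        unfolding S_def by (simp add: \<eta> V W1)
    qed
    moreover have "card S = 4" "S \<subseteq> N" using ijk l by (simp_all add: S_def)
    ultimately show ?thesis by blast
  qed
qed

section \<open>From unordered index pairs back to weights on hyperplanes\<close>

definition hyp_between :: "nat \<Rightarrow> nat \<Rightarrow> bool \<Rightarrow> hyp" where
  "hyp_between p q s = (min p q, max p q, s)"

lemma hyp_between_commute: "hyp_between p q s = hyp_between q p s"
  by (simp add: hyp_between_def min.commute max.commute)

lemma ends_hyp_between [simp]: "ends (hyp_between p q s) = {p, q}"
  by (auto simp: hyp_between_def min_def max_def)

text \<open>\<open>triangles\<close> fixes an increasing order of the indices, while
  \<open>p\<close>, \<open>q\<close>, \<open>r\<close> come in any order. Alternation extends the
  cyclic equalities of a triangle to reversed cycles, which settles all six orders.\<close>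

lemma flat_relations_hyp_between:
  assumes fl: "flat_relations n \<omega>" and N: "{p, q, r} \<subseteq> {1..n}" "distinct [p, q, r]"
  shows "\<omega> (hyp_between p q s, hyp_between q r t) = \<omega> (hyp_between q r t, hyp_between r p (s \<noteq> t))"
proof -
  have cyc: "\<omega> (H, K) = \<omega> (K, L)" "\<omega> (K, L) = \<omega> (L, H)" "\<omega> (L, H) = \<omega> (H, K)"
      "\<omega> (K, H) = \<omega> (H, L)" "\<omega> (H, L) = \<omega> (L, K)" "\<omega> (L, K) = \<omega> (K, H)"
    if HKL: "(H, K, L) \<in> triangles n" for H K L
  proof -
    note D = flat_relationsD(4)[OF fl HKL] flat_relationsD(5)[OF fl HKL]
    show "\<omega> (H, K) = \<omega> (K, L)" "\<omega> (K, L) = \<omega> (L, H)" by (fact D)+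
    show "\<omega> (L, H) = \<omega> (H, K)" using D by simp
    have "- \<omega> (H, K) = - \<omega> (L, H)" "- \<omega> (L, H) = - \<omega> (K, L)" "- \<omega> (K, L) = - \<omega> (H, K)"
      using D by simp_all
    then show "\<omega> (K, H) = \<omega> (H, L)" "\<omega> (H, L) = \<omega> (L, K)" "\<omega> (L, K) = \<omega> (K, H)"
      unfolding flat_relationsD(1)[OF fl, symmetric] .
  qed
  have tri: "((i, j, a), (j, k, b), (i, k, c)) \<in> triangles n"
    if "i \<in> {1..n}" "k \<in> {1..n}" "i < j" "j < k" "c = (a \<noteq> b)" for i j k a b c
    using that by (auto simp: triangles_def)
  have h: "hyp_between p q s = (p, q, s)" "hyp_between q p s = (p, q, s)" if "p < q" for p q s
    using that by (simp_all add: hyp_between_def)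
  have N': "p \<in> {1..n}" "q \<in> {1..n}" "r \<in> {1..n}" using N by auto
  have "p < q \<and> q < r \<and> p < r \<or> p < r \<and> r < q \<and> p < q \<or> q < p \<and> p < r \<and> q < r
    \<or> q < r \<and> r < p \<and> q < p \<or> r < p \<and> p < q \<and> r < q \<or> r < q \<and> q < p \<and> r < p"
    using N(2) by simp linarith
  then consider "p < q" "q < r" "p < r" | "p < r" "r < q" "p < q" | "q < p" "p < r" "q < r"
    | "q < r" "r < p" "q < p" | "r < p" "p < q" "r < q" | "r < q" "q < p" "r < p"
    by blast
  then show ?thesis
  proof cases
    case 1
    note t = tri[OF N'(1,3) 1(1,2), of "s \<noteq> t" s t]
    show ?thesis unfolding h[OF 1(1)] h[OF 1(2)] h[OF 1(3)] by (rule cyc[OF t]) auto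
  next
    case 2
    note t = tri[OF N'(1,2) 2(1,2), of s "s \<noteq> t" t]
    show ?thesis unfolding h[OF 2(1)] h[OF 2(2)] h[OF 2(3)] by (rule cyc[OF t]) auto
  next
    case 3
    note t = tri[OF N'(2,3) 3(1,2), of t s "s \<noteq> t"]
    show ?thesis unfolding h[OF 3(1)] h[OF 3(2)] h[OF 3(3)] by (rule cyc[OF t]) auto
  next
    case 4
    note t = tri[OF N'(2,1) 4(1,2), of s t "s \<noteq> t"]
    show ?thesis unfolding h[OF 4(1)] h[OF 4(2)] h[OF 4(3)] by (rule cyc[OF t]) auto
  next
    case 5
    note t = tri[OF N'(3,2) 5(1,2), of t "s \<noteq> t" s]
    show ?thesis unfolding h[OF 5(1)] h[OF 5(2)] h[OF 5(3)] by (rule cyc[OF t]) auto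
  next
    case 6
    note t = tri[OF N'(3,1) 6(1,2), of "s \<noteq> t" t s]
    show ?thesis unfolding h[OF 6(1)] h[OF 6(2)] h[OF 6(3)] by (rule cyc[OF t]) auto
  qed
qed

text \<open>One description for every kind of component: size 3 of \<open>S\<close> gives
  \<open>A_3\<close>, or the \<open>A_4\<close> type on a triple if \<open>full\<close>; size 4
  gives \<open>A_4\<close>, or \<open>D_4\<close> if \<open>full\<close>. Equations replace
  partitions here, which avoids a distinction by kind until the comparison with the list.\<close>

definition component_space :: "nat set \<Rightarrow> (nat \<Rightarrow> bool) \<Rightarrow> bool \<Rightarrow> (hyp \<Rightarrow> 'k::field) set" where
  "component_space S \<epsilon> full = {a.
     (\<forall>p q s. a (p, q, s) = (if p < q \<and> p \<in> S \<and> q \<in> S \<and> (full \<or> s = (\<epsilon> p \<noteq> \<epsilon> q))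
        then a (p, q, \<epsilon> p \<noteq> \<epsilon> q) else 0)) \<and>
     (\<forall>p\<in>S. \<forall>q\<in>S. \<forall>r\<in>S. p < q \<and> q < r \<longrightarrow>
        a (p, q, \<epsilon> p \<noteq> \<epsilon> q) + a (q, r, \<epsilon> q \<noteq> \<epsilon> r) + a (p, r, \<epsilon> p \<noteq> \<epsilon> r) = 0) \<and>
     (\<forall>p\<in>S. \<forall>q\<in>S. \<forall>r\<in>S. \<forall>t\<in>S. p < q \<and> r < t \<and> distinct [p, q, r, t] \<longrightarrow>
        a (p, q, \<epsilon> p \<noteq> \<epsilon> q) = a (r, t, \<epsilon> r \<noteq> \<epsilon> t))}"

lemma component_spaceI:
  assumes "\<And>p q s. a (p, q, s) = (if p < q \<and> p \<in> S \<and> q \<in> S \<and> (full \<or> s = (\<epsilon> p \<noteq> \<epsilon> q))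
        then a (p, q, \<epsilon> p \<noteq> \<epsilon> q) else 0)"
    and "\<And>p q r. {p, q, r} \<subseteq> S \<Longrightarrow> p < q \<Longrightarrow> q < r \<Longrightarrow>
        a (p, q, \<epsilon> p \<noteq> \<epsilon> q) + a (q, r, \<epsilon> q \<noteq> \<epsilon> r) + a (p, r, \<epsilon> p \<noteq> \<epsilon> r) = 0"
    and "\<And>p q r t. {p, q, r, t} \<subseteq> S \<Longrightarrow> p < q \<Longrightarrow> r < t \<Longrightarrow> distinct [p, q, r, t] \<Longrightarrow>
        a (p, q, \<epsilon> p \<noteq> \<epsilon> q) = a (r, t, \<epsilon> r \<noteq> \<epsilon> t)"
  shows "a \<in> component_space S \<epsilon> full"
  unfolding component_space_def
proof (intro CollectI conjI allI ballI impI)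
  fix p q s
  show "a (p, q, s) = (if p < q \<and> p \<in> S \<and> q \<in> S \<and> (full \<or> s = (\<epsilon> p \<noteq> \<epsilon> q))
        then a (p, q, \<epsilon> p \<noteq> \<epsilon> q) else 0)" by (rule assms(1))
next
  fix p q r assume "p \<in> S" "q \<in> S" "r \<in> S" "p < q \<and> q < r"
  then show "a (p, q, \<epsilon> p \<noteq> \<epsilon> q) + a (q, r, \<epsilon> q \<noteq> \<epsilon> r) + a (p, r, \<epsilon> p \<noteq> \<epsilon> r) = 0"
    by (intro assms(2)) auto
next
  fix p q r t assume "p \<in> S" "q \<in> S" "r \<in> S" "t \<in> S" "p < q \<and> r < t \<and> distinct [p, q, r, t]"
  then show "a (p, q, \<epsilon> p \<noteq> \<epsilon> q) = a (r, t, \<epsilon> r \<noteq> \<epsilon> t)"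
    by (intro assms(3)) auto
qed

lemma component_spaceD:
  assumes "a \<in> component_space S \<epsilon> full"
  shows "p < q \<Longrightarrow> p \<in> S \<Longrightarrow> q \<in> S \<Longrightarrow> full \<or> s = (\<epsilon> p \<noteq> \<epsilon> q) \<Longrightarrow> a (p, q, s) = a (p, q, \<epsilon> p \<noteq> \<epsilon> q)"
    and "\<not> (p < q \<and> p \<in> S \<and> q \<in> S \<and> (full \<or> s = (\<epsilon> p \<noteq> \<epsilon> q))) \<Longrightarrow> a (p, q, s) = 0"
    and "p \<in> S \<Longrightarrow> q \<in> S \<Longrightarrow> r \<in> S \<Longrightarrow> p < q \<Longrightarrow> q < r \<Longrightarrow>
        a (p, q, \<epsilon> p \<noteq> \<epsilon> q) + a (q, r, \<epsilon> q \<noteq> \<epsilon> r) + a (p, r, \<epsilon> p \<noteq> \<epsilon> r) = 0"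
    and "p \<in> S \<Longrightarrow> q \<in> S \<Longrightarrow> r \<in> S \<Longrightarrow> t \<in> S \<Longrightarrow> p < q \<Longrightarrow> r < t \<Longrightarrow> distinct [p, q, r, t] \<Longrightarrow>
        a (p, q, \<epsilon> p \<noteq> \<epsilon> q) = a (r, t, \<epsilon> r \<noteq> \<epsilon> t)"
proof -
  note C = assms[unfolded component_space_def mem_Collect_eq]
  note 1 = C[THEN conjunct1, THEN spec, THEN spec, THEN spec]
  show "p < q \<Longrightarrow> p \<in> S \<Longrightarrow> q \<in> S \<Longrightarrow> full \<or> s = (\<epsilon> p \<noteq> \<epsilon> q) \<Longrightarrow> a (p, q, s) = a (p, q, \<epsilon> p \<noteq> \<epsilon> q)"
    by (rule trans[OF 1]) simp
  show "\<not> (p < q \<and> p \<in> S \<and> q \<in> S \<and> (full \<or> s = (\<epsilon> p \<noteq> \<epsilon> q))) \<Longrightarrow> a (p, q, s) = 0"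
    by (rule trans[OF 1], rule if_not_P)
  show "p \<in> S \<Longrightarrow> q \<in> S \<Longrightarrow> r \<in> S \<Longrightarrow> p < q \<Longrightarrow> q < r \<Longrightarrow>
        a (p, q, \<epsilon> p \<noteq> \<epsilon> q) + a (q, r, \<epsilon> q \<noteq> \<epsilon> r) + a (p, r, \<epsilon> p \<noteq> \<epsilon> r) = 0"
    by (rule C[THEN conjunct2, THEN conjunct1, rule_format]) simp_all
  show "p \<in> S \<Longrightarrow> q \<in> S \<Longrightarrow> r \<in> S \<Longrightarrow> t \<in> S \<Longrightarrow> p < q \<Longrightarrow> r < t \<Longrightarrow> distinct [p, q, r, t] \<Longrightarrow>
        a (p, q, \<epsilon> p \<noteq> \<epsilon> q) = a (r, t, \<epsilon> r \<noteq> \<epsilon> t)"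
    by (rule C[THEN conjunct2, THEN conjunct2, rule_format]) simp_all
qed

text \<open>In \<open>st\<close> signs refer to coordinates changed by \<open>\<epsilon>\<close>,
  and \<open>\<eta>\<close> selects a braid arrangement in those coordinates. Returning to the
  original coordinates composes the two changes, so the sign vector becomes their exclusive
  or.\<close>

lemma structured_imp_component_space:
  assumes "a \<in> ambient n" and S: "S \<subseteq> {1..n}"
    and st: "structured {1..n} S \<eta> full (\<lambda>p q s. a (hyp_between p q (s \<noteq> (\<epsilon> p \<noteq> \<epsilon> q))))"
  shows "a \<in> component_space S (\<lambda>p. \<epsilon> p \<noteq> \<eta> p) full"
proof (rule component_spaceI)
  have val: "p \<in> {1..n} \<Longrightarrow> q \<in> {1..n} \<Longrightarrow> p \<noteq> q \<Longrightarrow> a (hyp_between p q (s \<noteq> (\<epsilon> p \<noteq> \<epsilon> q))) =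
      (if p \<in> S \<and> q \<in> S \<and> (full \<or> s = (\<eta> p \<noteq> \<eta> q)) then a (hyp_between p q ((\<eta> p \<noteq> \<eta> q) \<noteq> (\<epsilon> p \<noteq> \<epsilon> q))) else 0)" for p q s
    by (rule st[unfolded structured_def, THEN conjunct1, rule_format])
  have xor: "((s \<noteq> t) \<noteq> t) = s" "((\<eta> p \<noteq> \<eta> q) \<noteq> (\<epsilon> p \<noteq> \<epsilon> q)) = ((\<epsilon> p \<noteq> \<eta> p) \<noteq> (\<epsilon> q \<noteq> \<eta> q))"
    "((s \<noteq> (\<epsilon> p \<noteq> \<epsilon> q)) = (\<eta> p \<noteq> \<eta> q)) = (s = ((\<epsilon> p \<noteq> \<eta> p) \<noteq> (\<epsilon> q \<noteq> \<eta> q)))" for s t p q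
    by auto
  fix p q s
  show "a (p, q, s) = (if p < q \<and> p \<in> S \<and> q \<in> S \<and> (full \<or> s = ((\<epsilon> p \<noteq> \<eta> p) \<noteq> (\<epsilon> q \<noteq> \<eta> q)))
        then a (p, q, (\<epsilon> p \<noteq> \<eta> p) \<noteq> (\<epsilon> q \<noteq> \<eta> q)) else 0)"
  proof (cases "p < q \<and> p \<in> {1..n} \<and> q \<in> {1..n}")
    case True
    then have h: "hyp_between p q s = (p, q, s)" for s by (simp add: hyp_between_def)
    show ?thesis using val[of p q "s \<noteq> (\<epsilon> p \<noteq> \<epsilon> q)"] True unfolding xor h by simp
  next
    case False
    then have "(p, q, s) \<notin> Hyp n" by (auto simp: Hyp_def)
    then have "a (p, q, s) = 0" using assms(1) by (auto simp: ambient_def)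
    then show ?thesis using False S by auto
  qed
next
  have xor: "((\<epsilon> p \<noteq> \<eta> p) \<noteq> (\<epsilon> q \<noteq> \<eta> q)) = ((\<eta> p \<noteq> \<eta> q) \<noteq> (\<epsilon> p \<noteq> \<epsilon> q))" for p q by auto
  have h: "hyp_between p q s = (p, q, s)" if "p < q" for p q s using that by (simp add: hyp_between_def)
  fix p q r assume "{p, q, r} \<subseteq> S" "p < q" "q < r"
  moreover from this have "distinct [p, q, r]" "p < r" by auto
  moreover have "\<forall>p\<in>S. \<forall>q\<in>S. \<forall>r\<in>S. distinct [p, q, r] \<longrightarrow> a (hyp_between p q ((\<eta> p \<noteq> \<eta> q) \<noteq> (\<epsilon> p \<noteq> \<epsilon> q)))
      + a (hyp_between q r ((\<eta> q \<noteq> \<eta> r) \<noteq> (\<epsilon> q \<noteq> \<epsilon> r))) + a (hyp_between p r ((\<eta> p \<noteq> \<eta> r) \<noteq> (\<epsilon> p \<noteq> \<epsilon> r))) = 0"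
    by (rule st[unfolded structured_def, THEN conjunct2, THEN conjunct1])
  ultimately show "a (p, q, (\<epsilon> p \<noteq> \<eta> p) \<noteq> (\<epsilon> q \<noteq> \<eta> q)) + a (q, r, (\<epsilon> q \<noteq> \<eta> q) \<noteq> (\<epsilon> r \<noteq> \<eta> r))
      + a (p, r, (\<epsilon> p \<noteq> \<eta> p) \<noteq> (\<epsilon> r \<noteq> \<eta> r)) = 0"
    unfolding xor by (metis h insert_subset)
next
  have xor: "((\<epsilon> p \<noteq> \<eta> p) \<noteq> (\<epsilon> q \<noteq> \<eta> q)) = ((\<eta> p \<noteq> \<eta> q) \<noteq> (\<epsilon> p \<noteq> \<epsilon> q))" for p q by auto
  have h: "hyp_between p q s = (p, q, s)" if "p < q" for p q s using that by (simp add: hyp_between_def)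
  fix p q r t assume "{p, q, r, t} \<subseteq> S" "p < q" "r < t" "distinct [p, q, r, t]"
  moreover have "\<forall>p\<in>S. \<forall>q\<in>S. \<forall>r\<in>S. \<forall>t\<in>S. distinct [p, q, r, t] \<longrightarrow>
      a (hyp_between p q ((\<eta> p \<noteq> \<eta> q) \<noteq> (\<epsilon> p \<noteq> \<epsilon> q))) = a (hyp_between r t ((\<eta> r \<noteq> \<eta> t) \<noteq> (\<epsilon> r \<noteq> \<epsilon> t)))"
    by (rule st[unfolded structured_def, THEN conjunct2, THEN conjunct2])
  ultimately show "a (p, q, (\<epsilon> p \<noteq> \<eta> p) \<noteq> (\<epsilon> q \<noteq> \<eta> q)) = a (r, t, (\<epsilon> r \<noteq> \<eta> r) \<noteq> (\<epsilon> t \<noteq> \<eta> t))"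
    unfolding xor by (metis h insert_subset)
qed

text \<open>On the support, commuting hyperplanes have equal weights in \<open>a\<close> and in
  \<open>b\<close>, so their determinant vanishes; on a triangle inside the support both weights sum
  to zero, which makes the three determinants equal.\<close>

lemma flat_relations_component_space:
  assumes a: "a \<in> component_space S \<epsilon> full" and b: "b \<in> component_space S \<epsilon> full"
    and S: "S \<subseteq> {1..n}"
  shows "flat_relations n (wedge a b)"
proof (rule flat_relationsI)
  show "wedge a b (y, x) = - wedge a b (x, y)" for x y by (simp add: wedge_def)
  define M where "M = {(p, q, s). p < q \<and> p \<in> S \<and> q \<in> S \<and> (full \<or> s = (\<epsilon> p \<noteq> \<epsilon> q))}"
  have out: "a x = 0" "b x = 0" if "x \<notin> M" for x
    using that component_spaceD(2)[OF a] component_spaceD(2)[OF b]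
    by (cases x; auto simp: M_def)+
  have w0: "wedge a b (x, y) = 0" if "x \<notin> M \<or> y \<notin> M" for x y
    using that out[of x] out[of y] by (auto simp: wedge_def)
  show "wedge a b (x, y) = 0" if c: "commuting x y" for x y
  proof (cases "x \<in> M \<and> y \<in> M")
    case True
    obtain p q s p' q' s' where xy: "x = (p, q, s)" "y = (p', q', s')" by (metis prod_cases3)
    have mem: "p < q" "p \<in> S" "q \<in> S" "full \<or> s = (\<epsilon> p \<noteq> \<epsilon> q)"
      "p' < q'" "p' \<in> S" "q' \<in> S" "full \<or> s' = (\<epsilon> p' \<noteq> \<epsilon> q')"
      using True by (auto simp: M_def xy)
    have eq: "u x = u y" if u: "u \<in> component_space S \<epsilon> full" for u :: "hyp \<Rightarrow> 'a"
    proof -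
      have "u x = u (p, q, \<epsilon> p \<noteq> \<epsilon> q)" "u y = u (p', q', \<epsilon> p' \<noteq> \<epsilon> q')"
        unfolding xy using mem by (intro component_spaceD(1)[OF u]; simp)+
      moreover have "u (p, q, \<epsilon> p \<noteq> \<epsilon> q) = u (p', q', \<epsilon> p' \<noteq> \<epsilon> q')"
      proof (cases "ends x = ends y")
        case True
        then have "p' = p" "q' = q" using mem by (auto simp: xy doubleton_eq_iff)
        then show ?thesis by simp
      next
        case False
        then have "distinct [p, q, p', q']" using c mem unfolding commuting_def by (auto simp: xy)
        then show ?thesis using mem by (intro component_spaceD(4)[OF u]) auto
      qed
      ultimately show ?thesis by simp
    qed
    show ?thesis using eq[OF a] eq[OF b] by (simp add: wedge_def)
  qed (use w0 in blast)
  show "wedge a b (x, y) = 0" if "x \<notin> Hyp n \<or> y \<notin> Hyp n" for x y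
  proof (rule w0)
    have "M \<subseteq> Hyp n" using S by (auto simp: M_def Hyp_def)
    then show "x \<notin> M \<or> y \<notin> M" using that by blast
  qed
  fix H K L assume "(H, K, L) \<in> triangles n"
  then obtain p q r s t where t: "H = (p, q, s)" "K = (q, r, t)" "L = (p, r, s \<noteq> t)" and lt: "p < q" "q < r"
    unfolding triangles_def by blast
  show "wedge a b (H, K) = wedge a b (K, L) \<and> wedge a b (K, L) = wedge a b (L, H)"
  proof (cases "p \<in> S \<and> q \<in> S \<and> r \<in> S \<and> (full \<or> (s = (\<epsilon> p \<noteq> \<epsilon> q) \<and> t = (\<epsilon> q \<noteq> \<epsilon> r)))")
    case True
    have sum: "u H + u K + u L = 0" if u: "u \<in> component_space S \<epsilon> full" for u :: "hyp \<Rightarrow> 'a"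
    proof -
      have "u H = u (p, q, \<epsilon> p \<noteq> \<epsilon> q)" "u K = u (q, r, \<epsilon> q \<noteq> \<epsilon> r)" "u L = u (p, r, \<epsilon> p \<noteq> \<epsilon> r)"
        unfolding t using True lt by (intro component_spaceD(1)[OF u]; auto)+
      then show ?thesis using component_spaceD(3)[OF u, of p q r] True lt by simp
    qed
    have L: "a L = - a H - a K" "b L = - b H - b K"
      using sum[OF a] sum[OF b] by (simp_all add: eq_neg_iff_add_eq_0 algebra_simps)
    show ?thesis unfolding wedge_def prod.case L by (simp add: algebra_simps)
  next
    case False
    \<comment> \<open>An index outside \<open>S\<close> removes two sides. Otherwise the parity of
      the signs makes the number of sides disagreeing with \<open>\<epsilon>\<close> even, hence
      two. Either way every pair of corners meets the complement of \<open>M\<close>.\<close>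
    then have "H \<notin> M \<and> K \<notin> M \<or> K \<notin> M \<and> L \<notin> M \<or> L \<notin> M \<and> H \<notin> M"
      unfolding t M_def by auto
    then show ?thesis using w0 by metis
  qed
qed

lemma not_commuting_hyp_between:
  assumes "x \<in> Hyp n" "y \<in> Hyp n" "\<not> commuting x y"
  shows "\<exists>i j k s t. {i, j, k} \<subseteq> {1..n} \<and> distinct [i, j, k] \<and> x = hyp_between i j s \<and> y = hyp_between j k t"
proof -
  obtain p q s p' q' t where xy: "x = (p, q, s)" "y = (p', q', t)" by (metis prod_cases3)
  have lt: "1 \<le> p" "p < q" "q \<le> n" "1 \<le> p'" "p' < q'" "q' \<le> n"
    using assms(1,2) by (auto simp: xy Hyp_def)
  have nc: "{p, q} \<noteq> {p', q'}" "{p, q} \<inter> {p', q'} \<noteq> {}"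
    using assms(3) by (auto simp: commuting_def xy)
  consider "p' = p" "q \<noteq> q'" | "p' = q" | "q' = p" | "q' = q" "p \<noteq> p'"
    using nc by auto
  then show ?thesis
  proof cases
    case 1
    then show ?thesis using lt
      by (intro exI[of _ q] exI[of _ p] exI[of _ q'] exI[of _ s] exI[of _ t]) (auto simp: xy hyp_between_def)
  next
    case 2
    then show ?thesis using lt
      by (intro exI[of _ p] exI[of _ q] exI[of _ q'] exI[of _ s] exI[of _ t]) (auto simp: xy hyp_between_def)
  next
    case 3
    then show ?thesis using lt
      by (intro exI[of _ q] exI[of _ p] exI[of _ p'] exI[of _ s] exI[of _ t]) (auto simp: xy hyp_between_def)
  next
    case 4
    then show ?thesis using lt
      by (intro exI[of _ p] exI[of _ q] exI[of _ p'] exI[of _ s] exI[of _ t]) (auto simp: xy hyp_between_def)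
  qed
qed

lemma zero_in_component_space: "(\<lambda>_. 0) \<in> component_space S \<epsilon> full"
  by (rule component_spaceI) simp_all

lemma resonance1_imp_component_space:
  fixes a :: "hyp \<Rightarrow> 'k::field"
  assumes "n \<ge> 3" "a \<in> resonance1 n"
  shows "\<exists>S \<epsilon> full. S \<subseteq> {1..n} \<and> (card S = 3 \<or> card S = 4) \<and> a \<in> component_space S \<epsilon> full"
proof -
  obtain b where a: "a \<in> ambient n" and nb: "\<And>c. b \<noteq> (\<lambda>h. c * a h)"
    and fl: "flat_relations n (wedge a b)"
    using assms(2) unfolding resonance1_def OS_ideal2_iff by blast
  show ?thesis
  proof (cases "\<exists>x y. wedge a b (x, y) \<noteq> 0")
    case True
    then obtain x y where xy: "wedge a b (x, y) \<noteq> 0" by blast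
    then have "x \<in> Hyp n" "y \<in> Hyp n" "\<not> commuting x y"
      using flat_relationsD(2,3)[OF fl] by metis+
    then obtain i j k s t where ijk: "{i, j, k} \<subseteq> {1..n}" "distinct [i, j, k]"
      and x: "x = hyp_between i j s" and y: "y = hyp_between j k t"
      using not_commuting_hyp_between by metis
    \<comment> \<open>With value \<open>s\<close> at \<open>i\<close>, \<open>t\<close> at
      \<open>k\<close> and \<open>False\<close> at \<open>j\<close>, the given hyperplanes
      \<open>x\<close> and \<open>y\<close> become minus hyperplanes in the changed
      coordinates.\<close>
    define \<epsilon> where "\<epsilon> = (\<lambda>p. p = i \<and> s \<or> p = k \<and> t)"
    define V where "V = (\<lambda>p q u. (a (hyp_between p q (u \<noteq> (\<epsilon> p \<noteq> \<epsilon> q))), b (hyp_between p q (u \<noteq> (\<epsilon> p \<noteq> \<epsilon> q)))))"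
    have cross2: "cross2 (V p q u) (V p' q' u') =
        wedge a b (hyp_between p q (u \<noteq> (\<epsilon> p \<noteq> \<epsilon> q)), hyp_between p' q' (u' \<noteq> (\<epsilon> p' \<noteq> \<epsilon> q')))" for p q u p' q' u'
      by (simp add: cross2_def V_def wedge_def)
    have "\<exists>S \<eta> full. S \<subseteq> {1..n} \<and> (card S = 3 \<or> card S = 4) \<and>
      structured {1..n} S \<eta> full (\<lambda>p q s. fst (V p q s))"
    proof (rule structured_if_triangle[OF _ _ _ _ ijk])
      show "V p q u = V q p u" for p q u
        unfolding V_def hyp_between_commute[of p q] by (simp add: eq_commute)
      show "cross2 (V p q u) (V p q v) = 0" for p q u v
        unfolding cross2 by (rule flat_relationsD(2)[OF fl]) (simp add: commuting_def)
      show "cross2 (V p q u) (V r w v) = 0" if "distinct [p, q, r, w]" for p q r w u v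
        unfolding cross2 by (rule flat_relationsD(2)[OF fl]) (use that in \<open>auto simp: commuting_def\<close>)
      show "cross2 (V p q u) (V q r v) = cross2 (V q r v) (V r p (u \<noteq> v))"
        if "{p, q, r} \<subseteq> {1..n}" "distinct [p, q, r]" for p q r u v
      proof -
        have "((u \<noteq> v) \<noteq> (\<epsilon> r \<noteq> \<epsilon> p)) = ((u \<noteq> (\<epsilon> p \<noteq> \<epsilon> q)) \<noteq> (v \<noteq> (\<epsilon> q \<noteq> \<epsilon> r)))" by auto
        then show ?thesis unfolding cross2 by (simp only: flat_relations_hyp_between[OF fl that])
      qed
      have "\<epsilon> i = s" "\<epsilon> j = False" "\<epsilon> k = t" using ijk(2) by (auto simp: \<epsilon>_def)
      then show "cross2 (V i j False) (V j k False) \<noteq> 0"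
        using xy unfolding cross2 x y by simp
    qed
    then obtain S \<eta> full where S: "S \<subseteq> {1..n}" "card S = 3 \<or> card S = 4"
      "structured {1..n} S \<eta> full (\<lambda>p q u. a (hyp_between p q (u \<noteq> (\<epsilon> p \<noteq> \<epsilon> q))))"
      unfolding V_def fst_conv by blast
    then show ?thesis using structured_imp_component_space[OF a S(1,3)] by blast
  next
    case False
    \<comment> \<open>If all determinants vanish, a nonzero \<open>a\<close> would have
      \<open>b\<close> as a multiple. The remaining zero weight lies in every component space, and
      \<open>n \<ge> 3\<close> guarantees that there is one.\<close>
    have "a = (\<lambda>_. 0)"
    proof (rule ccontr)
      assume "a \<noteq> (\<lambda>_. 0)"
      then obtain h where h: "a h \<noteq> 0" by blast
      have "b x = b h / a h * a x" for x
      proof -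
        have "wedge a b (h, x) = 0" using False by blast
        then show ?thesis using h by (simp add: wedge_def field_simps)
      qed
      then show False using nb[of "b h / a h"] by blast
    qed
    moreover have "{1, 2, 3} \<subseteq> {1..n}" "card {1, 2, 3 :: nat} = 3" using assms(1) by auto
    ultimately show ?thesis using zero_in_component_space by blast
  qed
qed

section \<open>Component spaces as partition spaces\<close>

definition pencil :: "(nat \<Rightarrow> bool) \<Rightarrow> bool \<Rightarrow> nat \<Rightarrow> nat \<Rightarrow> hyp set" where
  "pencil \<epsilon> full p q = {(p, q, s) |s. full \<or> s = (\<epsilon> p \<noteq> \<epsilon> q)}"

definition triple_partition :: "(nat \<Rightarrow> bool) \<Rightarrow> bool \<Rightarrow> nat \<Rightarrow> nat \<Rightarrow> nat \<Rightarrow> hyp set set" where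
  "triple_partition \<epsilon> full i j k = {pencil \<epsilon> full i j, pencil \<epsilon> full i k, pencil \<epsilon> full j k}"

definition quad_partition :: "(nat \<Rightarrow> bool) \<Rightarrow> bool \<Rightarrow> nat \<Rightarrow> nat \<Rightarrow> nat \<Rightarrow> nat \<Rightarrow> hyp set set" where
  "quad_partition \<epsilon> full i j k l = {pencil \<epsilon> full i j \<union> pencil \<epsilon> full k l,
     pencil \<epsilon> full i k \<union> pencil \<epsilon> full j l, pencil \<epsilon> full i l \<union> pencil \<epsilon> full j k}"

lemma mem_pencil [simp]:
  "(p, q, s) \<in> pencil \<epsilon> full i j \<longleftrightarrow> p = i \<and> q = j \<and> (full \<or> s = (\<epsilon> i \<noteq> \<epsilon> j))"
  by (auto simp: pencil_def)

lemma pencil_neq: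
  assumes "(p, q) \<noteq> (p', q')"
  shows "pencil \<epsilon> full p q \<noteq> pencil \<epsilon> full p' q'"
  using assms mem_pencil[of p q "\<epsilon> p \<noteq> \<epsilon> q"] by blast

lemma triple_partition_blocks:
  assumes "i < j" "j < k"
  shows "pencil \<epsilon> full i j \<noteq> pencil \<epsilon> full i k" "pencil \<epsilon> full i j \<noteq> pencil \<epsilon> full j k"
    "pencil \<epsilon> full i k \<noteq> pencil \<epsilon> full j k"
  using assms by (auto intro!: pencil_neq)

lemma quad_partition_blocks:
  assumes "i < j" "j < k" "k < l"
  shows "pencil \<epsilon> full i j \<union> pencil \<epsilon> full k l \<noteq> pencil \<epsilon> full i k \<union> pencil \<epsilon> full j l"
    "pencil \<epsilon> full i j \<union> pencil \<epsilon> full k l \<noteq> pencil \<epsilon> full i l \<union> pencil \<epsilon> full j k"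
    "pencil \<epsilon> full i k \<union> pencil \<epsilon> full j l \<noteq> pencil \<epsilon> full i l \<union> pencil \<epsilon> full j k"
proof -
  have "(i, j, \<epsilon> i \<noteq> \<epsilon> j) \<in> pencil \<epsilon> full i j \<union> pencil \<epsilon> full k l"
    "(i, j, \<epsilon> i \<noteq> \<epsilon> j) \<notin> pencil \<epsilon> full i k \<union> pencil \<epsilon> full j l"
    "(i, j, \<epsilon> i \<noteq> \<epsilon> j) \<notin> pencil \<epsilon> full i l \<union> pencil \<epsilon> full j k"
    "(i, k, \<epsilon> i \<noteq> \<epsilon> k) \<in> pencil \<epsilon> full i k \<union> pencil \<epsilon> full j l"
    "(i, k, \<epsilon> i \<noteq> \<epsilon> k) \<notin> pencil \<epsilon> full i l \<union> pencil \<epsilon> full j k"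
    using assms by auto
  then show "pencil \<epsilon> full i j \<union> pencil \<epsilon> full k l \<noteq> pencil \<epsilon> full i k \<union> pencil \<epsilon> full j l"
    "pencil \<epsilon> full i j \<union> pencil \<epsilon> full k l \<noteq> pencil \<epsilon> full i l \<union> pencil \<epsilon> full j k"
    "pencil \<epsilon> full i k \<union> pencil \<epsilon> full j l \<noteq> pencil \<epsilon> full i l \<union> pencil \<epsilon> full j k"
    by metis+
qed

lemma component_space_on_pencil:
  assumes "a \<in> component_space S \<epsilon> full" "H \<in> pencil \<epsilon> full p q" "p < q" "p \<in> S" "q \<in> S"
  shows "a H = a (p, q, \<epsilon> p \<noteq> \<epsilon> q)"
proof -
  obtain s where H: "H = (p, q, s)" and s: "full \<or> s = (\<epsilon> p \<noteq> \<epsilon> q)"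
    using assms(2) unfolding pencil_def by blast
  show ?thesis unfolding H by (rule component_spaceD(1)[OF assms(1,3-5) s])
qed

lemma component_space_eq_triple_partition:
  assumes lt: "i < j" "j < k"
  shows "component_space {i, j, k} \<epsilon> full = partition_space (triple_partition \<epsilon> full i j k)"
proof (rule set_eqI)
  fix a :: "hyp \<Rightarrow> 'a"
  note iff = partition_space_3_iff[OF triple_partition_blocks[OF lt], of a, folded triple_partition_def]
  show "a \<in> component_space {i, j, k} \<epsilon> full \<longleftrightarrow> a \<in> partition_space (triple_partition \<epsilon> full i j k)"
  proof
    assume a: "a \<in> component_space {i, j, k} \<epsilon> full"
    note D = component_spaceD[OF a]
    show "a \<in> partition_space (triple_partition \<epsilon> full i j k)"
      unfolding iff
    proof (intro exI conjI ballI allI impI)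
      show "a (i, j, \<epsilon> i \<noteq> \<epsilon> j) + a (i, k, \<epsilon> i \<noteq> \<epsilon> k) + a (j, k, \<epsilon> j \<noteq> \<epsilon> k) = 0"
        using D(3)[of i j k] lt by (simp add: add_ac)
      show "a H = a (i, j, \<epsilon> i \<noteq> \<epsilon> j)" if "H \<in> pencil \<epsilon> full i j" for H
        by (rule component_space_on_pencil[OF a that]) (use lt in auto)
      show "a H = a (i, k, \<epsilon> i \<noteq> \<epsilon> k)" if "H \<in> pencil \<epsilon> full i k" for H
        by (rule component_space_on_pencil[OF a that]) (use lt in auto)
      show "a H = a (j, k, \<epsilon> j \<noteq> \<epsilon> k)" if "H \<in> pencil \<epsilon> full j k" for H
        by (rule component_space_on_pencil[OF a that]) (use lt in auto)
      show "a H = 0" if H: "H \<notin> pencil \<epsilon> full i j \<union> pencil \<epsilon> full i k \<union> pencil \<epsilon> full j k" for H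
      proof -
        obtain p q s where pqs: "H = (p, q, s)" by (metis prod_cases3)
        show ?thesis unfolding pqs by (rule D(2)) (use H lt in \<open>auto simp: pqs\<close>)
      qed
    qed
  next
    assume "a \<in> partition_space (triple_partition \<epsilon> full i j k)"
    then obtain x y z where sum: "x + y + z = 0" and "\<forall>H\<in>pencil \<epsilon> full i j. a H = x"
      "\<forall>H\<in>pencil \<epsilon> full i k. a H = y" "\<forall>H\<in>pencil \<epsilon> full j k. a H = z"
      and out: "\<forall>H. H \<notin> pencil \<epsilon> full i j \<union> pencil \<epsilon> full i k \<union> pencil \<epsilon> full j k \<longrightarrow> a H = 0"
      unfolding iff by blast
    then have on: "full \<or> s = (\<epsilon> i \<noteq> \<epsilon> j) \<Longrightarrow> a (i, j, s) = x" "full \<or> s = (\<epsilon> i \<noteq> \<epsilon> k) \<Longrightarrow> a (i, k, s) = y"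
      "full \<or> s = (\<epsilon> j \<noteq> \<epsilon> k) \<Longrightarrow> a (j, k, s) = z" for s
      by simp_all
    show "a \<in> component_space {i, j, k} \<epsilon> full"
    proof (rule component_spaceI)
      fix p q s
      show "a (p, q, s) = (if p < q \<and> p \<in> {i, j, k} \<and> q \<in> {i, j, k} \<and> (full \<or> s = (\<epsilon> p \<noteq> \<epsilon> q))
        then a (p, q, \<epsilon> p \<noteq> \<epsilon> q) else 0)"
      proof (cases "p < q \<and> p \<in> {i, j, k} \<and> q \<in> {i, j, k} \<and> (full \<or> s = (\<epsilon> p \<noteq> \<epsilon> q))")
        case True
        then have "p = i \<and> q = j \<or> p = i \<and> q = k \<or> p = j \<and> q = k" using lt by auto
        then have "a (p, q, s) = a (p, q, \<epsilon> p \<noteq> \<epsilon> q)" using True on by (elim disjE) auto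
        then show ?thesis using True by simp
      next
        case False
        have "a (p, q, s) = 0" using False lt by (intro out[rule_format]) auto
        then show ?thesis unfolding if_not_P[OF False] .
      qed
    next
      fix p q r assume "{p, q, r} \<subseteq> {i, j, k}" "p < q" "q < r"
      then have "p = i \<and> q = j \<and> r = k" using lt by auto
      then show "a (p, q, \<epsilon> p \<noteq> \<epsilon> q) + a (q, r, \<epsilon> q \<noteq> \<epsilon> r) + a (p, r, \<epsilon> p \<noteq> \<epsilon> r) = 0"
        using sum by (simp add: on add_ac)
    next
      fix p q r t assume "{p, q, r, t} \<subseteq> {i, j, k}" "distinct [p, q, r, t]"
      then have False by auto
      then show "a (p, q, \<epsilon> p \<noteq> \<epsilon> q) = a (r, t, \<epsilon> r \<noteq> \<epsilon> t)" ..
    qed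
  qed
qed

text \<open>The blocks are the three ways to split four indices into two pairs, since disjoint pairs
  carry equal weights. Every triangle meets each block over exactly one index pair, so all its sum
  conditions are the single equation \<open>x + y + z = 0\<close>.\<close>

lemma component_space_eq_quad_partition:
  assumes lt: "i < j" "j < k" "k < l"
  shows "component_space {i, j, k, l} \<epsilon> full = partition_space (quad_partition \<epsilon> full i j k l)"
proof (rule set_eqI)
  fix a :: "hyp \<Rightarrow> 'a"
  note iff = partition_space_3_iff[OF quad_partition_blocks[OF lt], of a, folded quad_partition_def]
  have lt': "i < k" "i < l" "j < l" using lt by auto
  have pairs: "p = i \<and> q = j \<or> p = i \<and> q = k \<or> p = i \<and> q = l \<or> p = j \<and> q = k \<or> p = j \<and> q = l
      \<or> p = k \<and> q = l" if "p < q" "p \<in> {i, j, k, l}" "q \<in> {i, j, k, l}" for p q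
    using that lt lt' by auto
  show "a \<in> component_space {i, j, k, l} \<epsilon> full \<longleftrightarrow> a \<in> partition_space (quad_partition \<epsilon> full i j k l)"
  proof
    assume a: "a \<in> component_space {i, j, k, l} \<epsilon> full"
    note D = component_spaceD[OF a]
    have opp: "a (k, l, \<epsilon> k \<noteq> \<epsilon> l) = a (i, j, \<epsilon> i \<noteq> \<epsilon> j)" "a (j, l, \<epsilon> j \<noteq> \<epsilon> l) = a (i, k, \<epsilon> i \<noteq> \<epsilon> k)"
      "a (j, k, \<epsilon> j \<noteq> \<epsilon> k) = a (i, l, \<epsilon> i \<noteq> \<epsilon> l)"
      using lt lt' by (intro D(4); simp)+
    have on: "a H = a (p, q, \<epsilon> p \<noteq> \<epsilon> q)"
      if "H \<in> pencil \<epsilon> full p q" "p < q" "p \<in> {i, j, k, l}" "q \<in> {i, j, k, l}" for H p q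
      by (rule component_space_on_pencil[OF a that])
    show "a \<in> partition_space (quad_partition \<epsilon> full i j k l)"
      unfolding iff
    proof (intro exI conjI ballI allI impI)
      show "a (i, j, \<epsilon> i \<noteq> \<epsilon> j) + a (i, k, \<epsilon> i \<noteq> \<epsilon> k) + a (i, l, \<epsilon> i \<noteq> \<epsilon> l) = 0"
        using D(3)[of i j k] opp lt by (simp add: add_ac)
      show "a H = a (i, j, \<epsilon> i \<noteq> \<epsilon> j)" if "H \<in> pencil \<epsilon> full i j \<union> pencil \<epsilon> full k l" for H
        using that on[of H i j] on[of H k l] lt lt' opp by auto
      show "a H = a (i, k, \<epsilon> i \<noteq> \<epsilon> k)" if "H \<in> pencil \<epsilon> full i k \<union> pencil \<epsilon> full j l" for H
        using that on[of H i k] on[of H j l] lt lt' opp by auto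
      show "a H = a (i, l, \<epsilon> i \<noteq> \<epsilon> l)" if "H \<in> pencil \<epsilon> full i l \<union> pencil \<epsilon> full j k" for H
        using that on[of H i l] on[of H j k] lt lt' opp by auto
      show "a H = 0" if H: "H \<notin> pencil \<epsilon> full i j \<union> pencil \<epsilon> full k l \<union>
        (pencil \<epsilon> full i k \<union> pencil \<epsilon> full j l) \<union> (pencil \<epsilon> full i l \<union> pencil \<epsilon> full j k)" for H
      proof -
        obtain p q s where pqs: "H = (p, q, s)" by (metis prod_cases3)
        show ?thesis unfolding pqs
        proof (rule D(2), rule notI)
          assume A: "p < q \<and> p \<in> {i, j, k, l} \<and> q \<in> {i, j, k, l} \<and> (full \<or> s = (\<epsilon> p \<noteq> \<epsilon> q))"
          then have "p = i \<and> q = j \<or> p = i \<and> q = k \<or> p = i \<and> q = l \<or> p = j \<and> q = k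
            \<or> p = j \<and> q = l \<or> p = k \<and> q = l" by (intro pairs) simp_all
          then show False using H A unfolding pqs by (elim disjE) auto
        qed
      qed
    qed
  next
    assume "a \<in> partition_space (quad_partition \<epsilon> full i j k l)"
    then obtain x y z where sum: "x + y + z = 0"
      and "\<forall>H\<in>pencil \<epsilon> full i j \<union> pencil \<epsilon> full k l. a H = x"
      "\<forall>H\<in>pencil \<epsilon> full i k \<union> pencil \<epsilon> full j l. a H = y"
      "\<forall>H\<in>pencil \<epsilon> full i l \<union> pencil \<epsilon> full j k. a H = z"
      and out: "\<forall>H. H \<notin> pencil \<epsilon> full i j \<union> pencil \<epsilon> full k l \<union>
        (pencil \<epsilon> full i k \<union> pencil \<epsilon> full j l) \<union> (pencil \<epsilon> full i l \<union> pencil \<epsilon> full j k) \<longrightarrow> a H = 0"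
      unfolding iff by blast
    then have on: "full \<or> s = (\<epsilon> i \<noteq> \<epsilon> j) \<Longrightarrow> a (i, j, s) = x" "full \<or> s = (\<epsilon> k \<noteq> \<epsilon> l) \<Longrightarrow> a (k, l, s) = x"
      "full \<or> s = (\<epsilon> i \<noteq> \<epsilon> k) \<Longrightarrow> a (i, k, s) = y" "full \<or> s = (\<epsilon> j \<noteq> \<epsilon> l) \<Longrightarrow> a (j, l, s) = y"
      "full \<or> s = (\<epsilon> i \<noteq> \<epsilon> l) \<Longrightarrow> a (i, l, s) = z" "full \<or> s = (\<epsilon> j \<noteq> \<epsilon> k) \<Longrightarrow> a (j, k, s) = z" for s
      by simp_all
    show "a \<in> component_space {i, j, k, l} \<epsilon> full"
    proof (rule component_spaceI)
      fix p q s
      show "a (p, q, s) = (if p < q \<and> p \<in> {i, j, k, l} \<and> q \<in> {i, j, k, l} \<and> (full \<or> s = (\<epsilon> p \<noteq> \<epsilon> q))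
        then a (p, q, \<epsilon> p \<noteq> \<epsilon> q) else 0)"
      proof (cases "p < q \<and> p \<in> {i, j, k, l} \<and> q \<in> {i, j, k, l} \<and> (full \<or> s = (\<epsilon> p \<noteq> \<epsilon> q))")
        case True
        then have "a (p, q, s) = a (p, q, \<epsilon> p \<noteq> \<epsilon> q)" using pairs[of p q] on by (elim conjE disjE) auto
        then show ?thesis using True by simp
      next
        case False
        have "a (p, q, s) = 0" using False lt lt' by (intro out[rule_format]) auto
        then show ?thesis unfolding if_not_P[OF False] .
      qed
    next
      fix p q r assume pqr: "{p, q, r} \<subseteq> {i, j, k, l}" "p < q" "q < r"
      have "p = i \<and> q = j \<or> p = i \<and> q = k \<or> p = i \<and> q = l \<or> p = j \<and> q = k \<or> p = j \<and> q = l
        \<or> p = k \<and> q = l" "q = i \<and> r = j \<or> q = i \<and> r = k \<or> q = i \<and> r = l \<or> q = j \<and> r = k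
        \<or> q = j \<and> r = l \<or> q = k \<and> r = l" using pairs[of p q] pairs[of q r] pqr by simp_all
      then have "p = i \<and> q = j \<and> r = k \<or> p = i \<and> q = j \<and> r = l \<or> p = i \<and> q = k \<and> r = l
          \<or> p = j \<and> q = k \<and> r = l"
        using lt lt' by (elim disjE) simp_all
      then show "a (p, q, \<epsilon> p \<noteq> \<epsilon> q) + a (q, r, \<epsilon> q \<noteq> \<epsilon> r) + a (p, r, \<epsilon> p \<noteq> \<epsilon> r) = 0"
        using sum by (elim disjE conjE) (simp_all add: on add_ac)
    next
      fix p q r t assume pq: "{p, q, r, t} \<subseteq> {i, j, k, l}" "p < q" "r < t" and d: "distinct [p, q, r, t]"
      have "p = i \<and> q = j \<or> p = i \<and> q = k \<or> p = i \<and> q = l \<or> p = j \<and> q = k \<or> p = j \<and> q = l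
        \<or> p = k \<and> q = l" "r = i \<and> t = j \<or> r = i \<and> t = k \<or> r = i \<and> t = l \<or> r = j \<and> t = k \<or> r = j \<and> t = l
        \<or> r = k \<and> t = l" using pairs[of p q] pairs[of r t] pq by simp_all
      then show "a (p, q, \<epsilon> p \<noteq> \<epsilon> q) = a (r, t, \<epsilon> r \<noteq> \<epsilon> t)"
        using d by (elim disjE conjE) (simp_all add: on)
    qed
  qed
qed

subsection \<open>The list of partitions\<close>

definition partitions :: "nat \<Rightarrow> hyp set set set" where
  "partitions n =
     {P. \<exists>i j k. 1 \<le> i \<and> i < j \<and> j < k \<and> k \<le> n \<and> P \<in> triple_partitions i j k} \<union>
     {P. \<exists>i j k l. 1 \<le> i \<and> i < j \<and> j < k \<and> k < l \<and> l \<le> n \<and> P \<in> quad_partitions i j k l}"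

lemma Dn_components_eq: "Dn_components n = partition_space ` partitions n"
proof -
  have if_mem: "P \<in> (if c then X else {}) \<longleftrightarrow> c \<and> P \<in> X" for P c and X :: "hyp set set set" by simp
  have "(\<Union>i\<in>{1..n}. \<Union>j\<in>{1..n}. \<Union>k\<in>{1..n}. if i < j \<and> j < k then triple_partitions i j k else {})
    = {P. \<exists>i j k. 1 \<le> i \<and> i < j \<and> j < k \<and> k \<le> n \<and> P \<in> triple_partitions i j k}" (is "?A = ?B")
  proof (intro set_eqI iffI)
    fix P assume "P \<in> ?B"
    then obtain i j k where "1 \<le> i" "i < j" "j < k" "k \<le> n" "P \<in> triple_partitions i j k" by blast
    then show "P \<in> ?A" by (intro UN_I[of i] UN_I[of j] UN_I[of k]) auto
  next
    fix P assume "P \<in> ?A"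
    then obtain i j k where "i \<in> {1..n}" "k \<in> {1..n}" "i < j" "j < k" "P \<in> triple_partitions i j k"
      unfolding UN_iff if_mem by blast
    then show "P \<in> ?B" by (intro CollectI exI[of _ i] exI[of _ j] exI[of _ k]) simp
  qed
  moreover have "(\<Union>i\<in>{1..n}. \<Union>j\<in>{1..n}. \<Union>k\<in>{1..n}. \<Union>l\<in>{1..n}.
      if i < j \<and> j < k \<and> k < l then quad_partitions i j k l else {})
    = {P. \<exists>i j k l. 1 \<le> i \<and> i < j \<and> j < k \<and> k < l \<and> l \<le> n \<and> P \<in> quad_partitions i j k l}"
    (is "?A = ?B")
  proof (intro set_eqI iffI)
    fix P assume "P \<in> ?B"
    then obtain i j k l where "1 \<le> i" "i < j" "j < k" "k < l" "l \<le> n" "P \<in> quad_partitions i j k l"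
      by blast
    then show "P \<in> ?A" by (intro UN_I[of i] UN_I[of j] UN_I[of k] UN_I[of l]) auto
  next
    fix P assume "P \<in> ?A"
    then obtain i j k l where "i \<in> {1..n}" "l \<in> {1..n}" "i < j" "j < k" "k < l"
      "P \<in> quad_partitions i j k l"
      unfolding UN_iff if_mem by blast
    then show "P \<in> ?B" by (intro CollectI exI[of _ i] exI[of _ j] exI[of _ k] exI[of _ l]) simp
  qed
  ultimately show ?thesis unfolding Dn_components_def partitions_def by (simp only:)
qed

lemma pencil_False: "pencil \<epsilon> False p q = {(p, q, \<epsilon> p \<noteq> \<epsilon> q)}"
  and pencil_True: "pencil \<epsilon> True p q = {hp p q, hm p q}"
  by (auto simp: pencil_def)

lemma triple_partition_True: "triple_partition \<epsilon> True i j k = {{hp i j, hm i j}, {hp i k, hm i k}, {hp j k, hm j k}}"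
  by (simp add: triple_partition_def pencil_True)

lemma triple_partition_False: "triple_partition \<epsilon> False i j k =
    singletons {(i, j, \<epsilon> i \<noteq> \<epsilon> j), (i, k, \<epsilon> i \<noteq> \<epsilon> k), (j, k, \<epsilon> j \<noteq> \<epsilon> k)}"
  by (simp add: triple_partition_def pencil_False singletons_def)

lemma quad_partition_True: "quad_partition \<epsilon> True i j k l = quad_D4_partition i j k l"
  by (simp add: quad_partition_def pencil_True quad_D4_partition_def insert_commute)

lemma quad_partition_False: "quad_partition \<epsilon> False i j k l = quad_A4_partition \<epsilon> i j k l"
  by (simp add: quad_partition_def pencil_False quad_A4_partition_def Let_def insert_commute)

lemma triple_partitions_eq:
  assumes "i < j" "j < k"
  shows "triple_partitions i j k = {triple_partition \<epsilon> full i j k |\<epsilon> full. True}"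
proof (intro set_eqI iffI)
  have ne: "i \<noteq> j" "i \<noteq> k" "j \<noteq> k" "j \<noteq> i" "k \<noteq> i" "k \<noteq> j" using assms by auto
  fix P assume "P \<in> triple_partitions i j k"
  \<comment> \<open>Modulo complement, the eight sign vectors on three indices are represented by
    flipping nothing or exactly one index.\<close>
  moreover have "singletons {hm i j, hm i k, hm j k} = triple_partition (\<lambda>_. False) False i j k"
    "singletons {hp i j, hm i k, hp j k} = triple_partition (\<lambda>p. p = j) False i j k"
    "singletons {hm i j, hp i k, hp j k} = triple_partition (\<lambda>p. p = k) False i j k"
    "singletons {hp i j, hp i k, hm j k} = triple_partition (\<lambda>p. p = i) False i j k"
    using ne by (simp_all add: triple_partition_False)
  ultimately have "P \<in> {triple_partition (\<lambda>_. False) False i j k, triple_partition (\<lambda>p. p = j) False i j k,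
    triple_partition (\<lambda>p. p = k) False i j k, triple_partition (\<lambda>p. p = i) False i j k, triple_partition (\<lambda>_. False) True i j k}"
    unfolding triple_partitions_def triple_partition_True by (simp only:)
  then show "P \<in> {triple_partition \<epsilon> full i j k |\<epsilon> full. True}" by (elim insertE emptyE) blast+
next
  fix P assume "P \<in> {triple_partition \<epsilon> full i j k |\<epsilon> full. True}"
  then obtain \<epsilon> full where P: "P = triple_partition \<epsilon> full i j k" by blast
  show "P \<in> triple_partitions i j k"
  proof (cases full)
    case True
    then show ?thesis unfolding P by (simp add: triple_partition_True triple_partitions_def)
  next
    case False
    then have "P = triple_partition \<epsilon> False i j k" using P by simp
    then show ?thesis unfolding triple_partition_False triple_partitions_def
      by (cases "\<epsilon> i"; cases "\<epsilon> j"; cases "\<epsilon> k") simp_all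
  qed
qed

lemma quad_partitions_eq: "quad_partitions i j k l = {quad_partition \<epsilon> full i j k l |\<epsilon> full. True}"
proof (intro set_eqI iffI)
  fix P assume "P \<in> quad_partitions i j k l"
  then show "P \<in> {quad_partition \<epsilon> full i j k l |\<epsilon> full. True}"
    unfolding quad_partitions_def quad_partition_True[of "\<lambda>_. False", symmetric] quad_partition_False[symmetric] by blast
next
  fix P assume "P \<in> {quad_partition \<epsilon> full i j k l |\<epsilon> full. True}"
  then obtain \<epsilon> full where "P = quad_partition \<epsilon> full i j k l" by blast
  then show "P \<in> quad_partitions i j k l"
    unfolding quad_partitions_def by (cases full) (auto simp: quad_partition_True quad_partition_False)
qed

lemma partitions_cases:
  assumes "P \<in> partitions n"
  obtains (3) \<epsilon> full i j k where "1 \<le> i" "i < j" "j < k" "k \<le> n" "P = triple_partition \<epsilon> full i j k"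
  | (4) \<epsilon> full i j k l where "1 \<le> i" "i < j" "j < k" "k < l" "l \<le> n" "P = quad_partition \<epsilon> full i j k l"
proof -
  from assms consider
    i j k where "1 \<le> i" "i < j" "j < k" "k \<le> n" "P \<in> triple_partitions i j k"
    | i j k l where "1 \<le> i" "i < j" "j < k" "k < l" "l \<le> n" "P \<in> quad_partitions i j k l"
    unfolding partitions_def by blast
  then show thesis
  proof cases
    case (1 i j k)
    then obtain \<epsilon> full where "P = triple_partition \<epsilon> full i j k" using triple_partitions_eq[of i j k] by auto
    then show thesis using 3[OF 1(1-4)] by blast
  next
    case (2 i j k l)
    then obtain \<epsilon> full where "P = quad_partition \<epsilon> full i j k l" using quad_partitions_eq[of i j k l] by auto
    then show thesis using 4[OF 2(1-5)] by blast
  qed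
qed

lemma triple_partition_in_partitions:
  assumes "1 \<le> i" "i < j" "j < k" "k \<le> n"
  shows "triple_partition \<epsilon> full i j k \<in> partitions n"
proof -
  have "triple_partition \<epsilon> full i j k \<in> triple_partitions i j k"
    unfolding triple_partitions_eq[OF assms(2,3)] by blast
  then show ?thesis
    unfolding partitions_def using assms
    by (intro UnI1 CollectI exI[of _ i] exI[of _ j] exI[of _ k] conjI)
qed

lemma quad_partition_in_partitions:
  assumes "1 \<le> i" "i < j" "j < k" "k < l" "l \<le> n"
  shows "quad_partition \<epsilon> full i j k l \<in> partitions n"
proof -
  have "quad_partition \<epsilon> full i j k l \<in> quad_partitions i j k l"
    unfolding quad_partitions_eq by blast
  then show ?thesis
    unfolding partitions_def using assms
    by (intro UnI2 CollectI exI[of _ i] exI[of _ j] exI[of _ k] exI[of _ l] conjI)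
qed

lemma partition_on_3:
  assumes "A \<noteq> {}" "B \<noteq> {}" "C \<noteq> {}" "A \<inter> B = {}" "A \<inter> C = {}" "B \<inter> C = {}"
  shows "partition_on (\<Union>{A, B, C}) {A, B, C}" "card {A, B, C} = 3"
proof -
  have "A \<noteq> B" "A \<noteq> C" "B \<noteq> C" using assms by blast+
  then show "card {A, B, C} = 3" by simp
  have "B \<inter> A = {}" "C \<inter> A = {}" "C \<inter> B = {}" using assms by blast+
  then show "partition_on (\<Union>{A, B, C}) {A, B, C}"
    using assms by (simp add: partition_on_def disjoint_def)
qed

lemma pencil_nonempty: "pencil \<epsilon> full p q \<noteq> {}"
  using mem_pencil[of p q "\<epsilon> p \<noteq> \<epsilon> q"] by blast

lemma pencil_disjoint: "(p, q) \<noteq> (p', q') \<Longrightarrow> pencil \<epsilon> full p q \<inter> pencil \<epsilon> full p' q' = {}"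
  by (auto simp: pencil_def)

lemma partitions_valid:
  assumes "P \<in> partitions n"
  shows "partition_on (\<Union>P) P" "card P = 3" "\<Union>P \<subseteq> Hyp n"
proof -
  have "partition_on (\<Union>P) P \<and> card P = 3 \<and> \<Union>P \<subseteq> Hyp n"
    using assms
  proof (cases rule: partitions_cases)
    case (3 \<epsilon> full i j k)
    have "\<Union>P \<subseteq> Hyp n" using 3 by (auto simp: triple_partition_def pencil_def Hyp_def)
    moreover have "partition_on (\<Union>P) P" "card P = 3"
      unfolding 3(5) triple_partition_def using 3(2,3)
      by (intro partition_on_3 pencil_nonempty pencil_disjoint; simp)+
    ultimately show ?thesis by blast
  next
    case (4 \<epsilon> full i j k l)
    have "\<Union>P \<subseteq> Hyp n" using 4 by (auto simp: quad_partition_def pencil_def Hyp_def)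
    moreover have "partition_on (\<Union>P) P" "card P = 3"
      unfolding 4(6) quad_partition_def using 4(2-4)
      by (intro partition_on_3; simp add: pencil_nonempty Int_Un_distrib Int_Un_distrib2 pencil_disjoint)+
    ultimately show ?thesis by blast
  qed
  then show "partition_on (\<Union>P) P" "card P = 3" "\<Union>P \<subseteq> Hyp n" by auto
qed

text \<open>Supplies the second weight demanded by \<open>resonance1\<close>, also for
  \<open>a = 0\<close>. The two block differences against \<open>C\<close> cannot both be multiples
  of one vector: at a point of \<open>A\<close> the first is 1 and the second 0, so the second
  multiple would be zero.\<close>

lemma partition_space_not_collinear:
  fixes a :: "hyp \<Rightarrow> 'k::field"
  assumes "partition_on X P" "card P = 3"
  shows "\<exists>b\<in>partition_space P. \<forall>c. b \<noteq> (\<lambda>h. c * a h)"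
proof (rule ccontr)
  assume "\<not> ?thesis"
  then have mult: "\<exists>c. b = (\<lambda>h. c * a h)" if "b \<in> partition_space P" for b using that by blast
  have P0: "finite P" "disjoint P" "{} \<notin> P"
    using assms by (auto simp: partition_on_def card_ge_0_finite)
  obtain A B C where P: "P = {A, B, C}" and ne: "A \<noteq> B" "A \<noteq> C" "B \<noteq> C"
    using assms(2) by (rule card_eq_3E)
  obtain x y where xy: "x \<in> A" "y \<in> B" using P P0(3) by blast
  then have nin: "x \<notin> B" "x \<notin> C" using P P0(2) ne by (auto simp: disjoint_def)
  obtain c where c: "(\<lambda>H. if H \<in> A then 1 else if H \<in> C then -1 else 0) = (\<lambda>h. c * a h)"
    using mult[OF partition_space_block_diff[OF P0(1,2)], of A C] P ne by auto
  obtain d where d: "(\<lambda>H. if H \<in> B then 1 else if H \<in> C then -1 else 0) = (\<lambda>h. d * a h)"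
    using mult[OF partition_space_block_diff[OF P0(1,2)], of B C] P ne by auto
  have "c * a x = 1" "d * a x = 0" using fun_cong[OF c, of x] fun_cong[OF d, of x] xy nin by simp_all
  then have "d = 0" by auto
  moreover have "d * a y = 1" using fun_cong[OF d, of y] xy by simp
  ultimately show False by simp
qed

lemma component_space_subset_ambient:
  assumes "S \<subseteq> {1..n}"
  shows "component_space S \<epsilon> full \<subseteq> ambient n"
  unfolding ambient_def
proof (intro subsetI CollectI allI impI)
  fix a :: "hyp \<Rightarrow> 'a" and h
  assume a: "a \<in> component_space S \<epsilon> full" and "h \<notin> Hyp n"
  obtain p q s where h: "h = (p, q, s)" by (metis prod_cases3)
  show "a h = 0" unfolding h
    by (rule component_spaceD(2)[OF a]) (use \<open>h \<notin> Hyp n\<close> assms in \<open>auto simp: h Hyp_def\<close>)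
qed

lemma partitions_component_space:
  assumes "P \<in> partitions n"
  shows "\<exists>S \<epsilon> full. S \<subseteq> {1..n} \<and> partition_space P = (component_space S \<epsilon> full :: (hyp \<Rightarrow> 'k::field) set)"
  using assms
proof (cases rule: partitions_cases)
  case (3 \<epsilon> full i j k)
  then show ?thesis
    by (intro exI[of _ "{i, j, k}"] exI[of _ \<epsilon>] exI[of _ full]) (simp add: component_space_eq_triple_partition)
next
  case (4 \<epsilon> full i j k l)
  then show ?thesis
    by (intro exI[of _ "{i, j, k, l}"] exI[of _ \<epsilon>] exI[of _ full]) (simp add: component_space_eq_quad_partition)
qed

lemma sorted_card_3:
  fixes S :: "nat set"
  assumes "card S = 3"
  shows "\<exists>i j k. S = {i, j, k} \<and> i < j \<and> j < k"
proof -
  have fin: "finite S" using assms by (simp add: card_ge_0_finite)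
  have "length (sorted_list_of_set S) = 3" using assms fin by simp
  moreover have "\<exists>i j k. xs = [i, j, k]" if "length xs = 3" for xs :: "nat list"
    using that by (auto simp: length_Suc_conv numeral_3_eq_3)
  ultimately obtain i j k where xs: "sorted_list_of_set S = [i, j, k]" by blast
  have "set [i, j, k] = S" "sorted [i, j, k]" "distinct [i, j, k]"
    using fin unfolding xs[symmetric] by simp_all
  then have "S = {i, j, k}" "i < j" "j < k" by simp_all
  then show ?thesis by blast
qed

lemma sorted_card_4:
  fixes S :: "nat set"
  assumes "card S = 4"
  shows "\<exists>i j k l. S = {i, j, k, l} \<and> i < j \<and> j < k \<and> k < l"
proof -
  have fin: "finite S" using assms by (simp add: card_ge_0_finite)
  have "length (sorted_list_of_set S) = Suc 3" using assms fin by simp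
  moreover have "\<exists>i j k l. xs = [i, j, k, l]" if "length xs = Suc 3" for xs :: "nat list"
    using that by (auto simp: length_Suc_conv numeral_3_eq_3)
  ultimately obtain i j k l where xs: "sorted_list_of_set S = [i, j, k, l]" by blast
  have "set [i, j, k, l] = S" "sorted [i, j, k, l]" "distinct [i, j, k, l]"
    using fin unfolding xs[symmetric] by simp_all
  then have "S = {i, j, k, l}" "i < j" "j < k" "k < l" by simp_all
  then show ?thesis by blast
qed

lemma resonance1_eq:
  assumes "n \<ge> 3"
  shows "resonance1 n = \<Union>(Dn_components n :: (hyp \<Rightarrow> 'k::field) set set)"
proof (intro set_eqI iffI)
  fix a :: "hyp \<Rightarrow> 'k"
  assume "a \<in> resonance1 n"
  then obtain S \<epsilon> full where S: "S \<subseteq> {1..n}" "card S = 3 \<or> card S = 4" "a \<in> component_space S \<epsilon> full"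
    using resonance1_imp_component_space[OF assms] by blast
  have "\<exists>P\<in>partitions n. a \<in> partition_space P"
    using S(2)
  proof
    assume "card S = 3"
    then obtain i j k where ijk: "S = {i, j, k}" "i < j" "j < k" using sorted_card_3 by blast
    have "1 \<le> i" "k \<le> n" using S(1) ijk(1) by auto
    then have "triple_partition \<epsilon> full i j k \<in> partitions n" using ijk(2,3) by (intro triple_partition_in_partitions)
    moreover have "a \<in> partition_space (triple_partition \<epsilon> full i j k)"
      using S(3) unfolding ijk(1) component_space_eq_triple_partition[OF ijk(2,3)] .
    ultimately show ?thesis by blast
  next
    assume "card S = 4"
    then obtain i j k l where ijk: "S = {i, j, k, l}" "i < j" "j < k" "k < l" using sorted_card_4 by blast
    have "1 \<le> i" "l \<le> n" using S(1) ijk(1) by auto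
    then have "quad_partition \<epsilon> full i j k l \<in> partitions n" using ijk(2-4) by (intro quad_partition_in_partitions)
    moreover have "a \<in> partition_space (quad_partition \<epsilon> full i j k l)"
      using S(3) unfolding ijk(1) component_space_eq_quad_partition[OF ijk(2-4)] .
    ultimately show ?thesis by blast
  qed
  then show "a \<in> \<Union>(Dn_components n)" unfolding Dn_components_eq by blast
next
  fix a :: "hyp \<Rightarrow> 'k"
  assume "a \<in> \<Union>(Dn_components n)"
  then obtain P where P: "P \<in> partitions n" and a: "a \<in> partition_space P"
    unfolding Dn_components_eq by blast
  obtain b where b: "b \<in> partition_space P" "\<forall>c. b \<noteq> (\<lambda>h. c * a h)"
    using partition_space_not_collinear[OF partitions_valid(1,2)[OF P]] by blast
  obtain S \<epsilon> full where S: "S \<subseteq> {1..n}"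
    and eq: "partition_space P = (component_space S \<epsilon> full :: (hyp \<Rightarrow> 'k) set)"
    using partitions_component_space[OF P] by blast
  have "a \<in> ambient n" "b \<in> ambient n" using a b component_space_subset_ambient[OF S] unfolding eq by blast+
  moreover have "wedge a b \<in> OS_ideal2 n"
    unfolding OS_ideal2_iff using a b S unfolding eq by (intro flat_relations_component_space)
  ultimately show "a \<in> resonance1 n" using b(2) unfolding resonance1_def by blast
qed

subsection \<open>Counting the components\<close>

text \<open>The invariant used for counting: its fibres are the lists for one triple or one
  quadruple, and its size tells the two kinds apart.\<close>

definition index_set :: "hyp set set \<Rightarrow> nat set" where
  "index_set P = \<Union>(ends ` \<Union>P)"

lemma Union_ends_pencil: "\<Union>(ends ` pencil \<epsilon> full p q) = {p, q}"
  by (auto simp: pencil_def)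

lemma index_set_triple_partition: "index_set (triple_partition \<epsilon> full i j k) = {i, j, k}"
  by (auto simp: index_set_def triple_partition_def image_Un Union_ends_pencil simp del: UN_simps)

lemma index_set_quad_partition: "index_set (quad_partition \<epsilon> full i j k l) = {i, j, k, l}"
  by (auto simp: index_set_def quad_partition_def image_Un Union_ends_pencil simp del: UN_simps)

lemma sorted4_eq:
  fixes i j k l :: nat
  assumes "{i, j, k, l} = {i', j', k', l'}" "i < j" "j < k" "k < l" "i' < j'" "j' < k'" "k' < l'"
  shows "i' = i \<and> j' = j \<and> k' = k \<and> l' = l"
proof -
  have "sorted_list_of_set (set [i, j, k, l]) = [i, j, k, l]"
    "sorted_list_of_set (set [i', j', k', l']) = [i', j', k', l']"
    using assms(2-7) by (intro sorted_list_of_set.idem_if_sorted_distinct; simp)+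
  then show ?thesis using assms(1) by simp
qed

lemma card_set_if_distinct_map:
  assumes "distinct (map f xs)"
  shows "card (set xs) = length xs"
  using assms by (simp add: distinct_card distinct_map)

lemma card_triple_partitions:
  assumes "i < j" "j < k"
  shows "card (triple_partitions i j k) = 5"
proof -
  let ?xs = "[singletons {hm i j, hm i k, hm j k}, singletons {hp i j, hm i k, hp j k},
    singletons {hm i j, hp i k, hp j k}, singletons {hp i j, hp i k, hm j k},
    {{hp i j, hm i j}, {hp i k, hm i k}, {hp j k, hm j k}}]"
  \<comment> \<open>The first two memberships separate the four \<open>A_3\<close> partitions; the
    third separates the last of them from the one with both signs.\<close>
  let ?f = "\<lambda>P. (hp i j \<in> \<Union>P, hp i k \<in> \<Union>P, hm i j \<in> \<Union>P)"
  have "distinct (map ?f ?xs)" using assms by (simp add: singletons_def)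
  then have "card (set ?xs) = length ?xs" by (rule card_set_if_distinct_map)
  then show ?thesis unfolding triple_partitions_def by simp
qed

lemma card_quad_partitions:
  assumes "i < j" "j < k" "k < l"
  shows "card (quad_partitions i j k l) = 9"
proof -
  \<comment> \<open>Complementing if necessary, the sign at \<open>i\<close> is
    \<open>False\<close>; the remaining three free signs, relative to \<open>i\<close>, give the
    count 8.\<close>
  define g where "g = (\<lambda>(a, b, c). quad_A4_partition (\<lambda>p. p = j \<and> a \<or> p = k \<and> b \<or> p = l \<and> c) i j k l)"
  have ne: "i \<noteq> j" "i \<noteq> k" "i \<noteq> l" "j \<noteq> k" "j \<noteq> l" "k \<noteq> l"
    "j \<noteq> i" "k \<noteq> i" "l \<noteq> i" "k \<noteq> j" "l \<noteq> j" "l \<noteq> k" using assms by auto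
  have mem: "hp i j \<in> \<Union>(g (a, b, c)) \<longleftrightarrow> a" "hp i k \<in> \<Union>(g (a, b, c)) \<longleftrightarrow> b"
    "hp i l \<in> \<Union>(g (a, b, c)) \<longleftrightarrow> c" "hm i j \<in> \<Union>(g (a, b, c)) \<longleftrightarrow> \<not> a" for a b c
    using ne by (simp_all add: g_def quad_A4_partition_def Let_def)
  have "inj g"
  proof (rule injI)
    fix x y assume eq: "g x = g y"
    obtain a b c a' b' c' where xy: "x = (a, b, c)" "y = (a', b', c')" by (metis prod_cases3)
    show "x = y" using mem[of a b c] mem[of a' b' c'] eq unfolding xy by simp
  qed
  then have "card (range g) = card (UNIV :: (bool \<times> bool \<times> bool) set)" by (rule card_image)
  then have 8: "card (range g) = 8"
    by (simp add: UNIV_Times_UNIV[symmetric] card_cartesian_product del: UNIV_Times_UNIV)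
  have "quad_A4_partition \<epsilon> i j k l = g (\<epsilon> i \<noteq> \<epsilon> j, \<epsilon> i \<noteq> \<epsilon> k, \<epsilon> i \<noteq> \<epsilon> l)" for \<epsilon>
  proof -
    have "((\<epsilon> i \<noteq> \<epsilon> j) \<noteq> (\<epsilon> i \<noteq> \<epsilon> k)) = (\<epsilon> j \<noteq> \<epsilon> k)" "((\<epsilon> i \<noteq> \<epsilon> j) \<noteq> (\<epsilon> i \<noteq> \<epsilon> l)) = (\<epsilon> j \<noteq> \<epsilon> l)"
      "((\<epsilon> i \<noteq> \<epsilon> k) \<noteq> (\<epsilon> i \<noteq> \<epsilon> l)) = (\<epsilon> k \<noteq> \<epsilon> l)" by auto
    then show ?thesis using ne by (simp add: g_def quad_A4_partition_def Let_def)
  qed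
  then have "{quad_A4_partition \<epsilon> i j k l |\<epsilon>. True} \<subseteq> range g" by blast
  moreover have "range g \<subseteq> {quad_A4_partition \<epsilon> i j k l |\<epsilon>. True}" unfolding g_def by auto
  ultimately have range: "{quad_A4_partition \<epsilon> i j k l |\<epsilon>. True} = range g" by (rule subset_antisym)
  have "quad_D4_partition i j k l \<notin> range g"
  proof
    assume "quad_D4_partition i j k l \<in> range g"
    then obtain a b c where eq: "quad_D4_partition i j k l = g (a, b, c)" by auto
    have "hp i j \<in> \<Union>(quad_D4_partition i j k l)" "hm i j \<in> \<Union>(quad_D4_partition i j k l)"
      by (simp_all add: quad_D4_partition_def)
    then show False unfolding eq mem by blast
  qed
  then show ?thesis unfolding quad_partitions_def range using 8 by (simp add: card_ge_0_finite)
qed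

lemma card_fibers:
  assumes "finite T" "f ` T \<subseteq> U" "finite U" "\<And>S. S \<in> U \<Longrightarrow> card {x \<in> T. f x = S} = m"
  shows "card T = m * card U"
proof -
  have "T = (\<Union>S\<in>U. {x \<in> T. f x = S})" using assms(2) by blast
  also have "card \<dots> = (\<Sum>S\<in>U. card {x \<in> T. f x = S})"
    using assms(1,3) by (intro card_UN_disjoint) auto
  also have "\<dots> = m * card U" using assms(4) by simp
  finally show ?thesis .
qed

lemma finite_partitions: "finite (partitions n)"
proof (rule finite_subset)
  show "partitions n \<subseteq> Pow (Pow (Hyp n))" using partitions_valid(3) by blast
qed (simp add: finite_Hyp)

lemma card_partitions: "card (partitions n) = 5 * (n choose 3) + 9 * (n choose 4)"
proof -
  let ?T = "{P. \<exists>i j k. 1 \<le> i \<and> i < j \<and> j < k \<and> k \<le> n \<and> P \<in> triple_partitions i j k}"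
  let ?Q = "{P. \<exists>i j k l. 1 \<le> i \<and> i < j \<and> j < k \<and> k < l \<and> l \<le> n \<and> P \<in> quad_partitions i j k l}"
  have fin: "finite ?T" "finite ?Q"
    using finite_partitions[of n] unfolding partitions_def by simp_all
  have idx3: "index_set P = {i, j, k}" if "P \<in> triple_partitions i j k" "i < j" "j < k" for P i j k
    using that(1) unfolding triple_partitions_eq[OF that(2,3)] by (auto simp: index_set_triple_partition)
  have idx4: "index_set P = {i, j, k, l}" if "P \<in> quad_partitions i j k l" for P i j k l
    using that unfolding quad_partitions_eq by (auto simp: index_set_quad_partition)
  have "card ?T = 5 * card {S. S \<subseteq> {1..n} \<and> card S = 3}"
  proof (rule card_fibers[OF fin(1)])
    show "index_set ` ?T \<subseteq> {S. S \<subseteq> {1..n} \<and> card S = 3}"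
    proof (intro image_subsetI)
      fix P assume "P \<in> ?T"
      then obtain i j k where ijk: "1 \<le> i" "i < j" "j < k" "k \<le> n" "P \<in> triple_partitions i j k" by blast
      have "index_set P = {i, j, k}" by (rule idx3[OF ijk(5,2,3)])
      then show "index_set P \<in> {S. S \<subseteq> {1..n} \<and> card S = 3}" using ijk by simp
    qed
    fix S assume "S \<in> {S. S \<subseteq> {1..n} \<and> card S = 3}"
    then have card: "card S = 3" and N: "S \<subseteq> {1..n}" by simp_all
    obtain i j k where S: "S = {i, j, k}" and lt: "i < j" "j < k"
      using sorted_card_3[OF card] by blast
    have "{P \<in> ?T. index_set P = S} = triple_partitions i j k"
    proof (intro set_eqI iffI)
      fix P assume "P \<in> {P \<in> ?T. index_set P = S}"
      then obtain i' j' k' where P: "i' < j'" "j' < k'" "P \<in> triple_partitions i' j' k'"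
        and idx: "index_set P = S" by blast
      have "{i, j, k} = {i', j', k'}" using idx3[OF P(3,1,2)] idx S by simp
      then have "i' = i" "j' = j" "k' = k" using sorted3_eq[OF _ lt P(1,2)] by simp_all
      then show "P \<in> triple_partitions i j k" using P(3) by simp
    next
      fix P assume P: "P \<in> triple_partitions i j k"
      have "1 \<le> i" "k \<le> n" using N S by auto
      then have "P \<in> ?T" using P lt by (intro CollectI exI[of _ i] exI[of _ j] exI[of _ k] conjI)
      then show "P \<in> {P \<in> ?T. index_set P = S}" using idx3[OF P lt] S by simp
    qed
    then show "card {P \<in> ?T. index_set P = S} = 5" using card_triple_partitions[OF lt] by simp
  qed simp
  moreover have "card ?Q = 9 * card {S. S \<subseteq> {1..n} \<and> card S = 4}"
  proof (rule card_fibers[OF fin(2)])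
    show "index_set ` ?Q \<subseteq> {S. S \<subseteq> {1..n} \<and> card S = 4}"
    proof (intro image_subsetI)
      fix P assume "P \<in> ?Q"
      then obtain i j k l where ijk: "1 \<le> i" "i < j" "j < k" "k < l" "l \<le> n" "P \<in> quad_partitions i j k l"
        by blast
      have "index_set P = {i, j, k, l}" by (rule idx4[OF ijk(6)])
      then show "index_set P \<in> {S. S \<subseteq> {1..n} \<and> card S = 4}" using ijk by simp
    qed
    fix S assume "S \<in> {S. S \<subseteq> {1..n} \<and> card S = 4}"
    then have card: "card S = 4" and N: "S \<subseteq> {1..n}" by simp_all
    obtain i j k l where S: "S = {i, j, k, l}" and lt: "i < j" "j < k" "k < l"
      using sorted_card_4[OF card] by blast
    have "{P \<in> ?Q. index_set P = S} = quad_partitions i j k l"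
    proof (intro set_eqI iffI)
      fix P assume "P \<in> {P \<in> ?Q. index_set P = S}"
      then obtain i' j' k' l' where P: "i' < j'" "j' < k'" "k' < l'" "P \<in> quad_partitions i' j' k' l'"
        and idx: "index_set P = S" by blast
      have "{i, j, k, l} = {i', j', k', l'}" using idx4[OF P(4)] idx S by simp
      then have "i' = i" "j' = j" "k' = k" "l' = l" using sorted4_eq[OF _ lt P(1-3)] by simp_all
      then show "P \<in> quad_partitions i j k l" using P(4) by simp
    next
      fix P assume P: "P \<in> quad_partitions i j k l"
      have "1 \<le> i" "l \<le> n" using N S by auto
      then have "P \<in> ?Q" using P lt by (intro CollectI exI[of _ i] exI[of _ j] exI[of _ k] exI[of _ l] conjI)
      then show "P \<in> {P \<in> ?Q. index_set P = S}" using idx4[OF P] S by simp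
    qed
    then show "card {P \<in> ?Q. index_set P = S} = 9" using card_quad_partitions[OF lt] by simp
  qed simp
  moreover have "?T \<inter> ?Q = {}"
  proof (rule equals0I)
    fix P assume "P \<in> ?T \<inter> ?Q"
    then obtain i j k i' j' k' l' where P: "i < j" "j < k" "P \<in> triple_partitions i j k"
      "i' < j'" "j' < k'" "k' < l'" "P \<in> quad_partitions i' j' k' l'" by blast
    have "card {i, j, k} = card {i', j', k', l'}" using idx3[OF P(3,1,2)] idx4[OF P(7)] by simp
    then show False using P by simp
  qed
  ultimately show ?thesis
    unfolding partitions_def using card_Un_disjoint[OF fin]
    by (simp add: n_subsets)
qed

theorem theorem6p1:
  fixes n :: nat
  assumes "n \<ge> 3"
    and alg_closed: "\<forall>p :: 'k::field_char_0 poly. degree p > 0 \<longrightarrow> (\<exists>x. poly p x = 0)"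
  shows "(\<forall>C \<in> irr_components (ambient n) (resonance1 n :: (hyp \<Rightarrow> 'k) set). kdim C = 2)
       \<and> irr_components (ambient n) (resonance1 n :: (hyp \<Rightarrow> 'k) set) = Dn_components n
       \<and> card (irr_components (ambient n) (resonance1 n :: (hyp \<Rightarrow> 'k) set))
           = 5 * (n choose 3) + 9 * (n choose 4)"
proof -
  \<comment> \<open>Used twice: for the incomparability of the components, and for the injectivity
    that turns the number of partitions into the number of components.\<close>
  have eq: "P = Q" if "P \<in> partitions n" "Q \<in> partitions n"
    "(partition_space P :: (hyp \<Rightarrow> 'k) set) \<subseteq> partition_space Q" for P Q
    using partition_space_subset_imp_eq partitions_valid(1,2) that by metis
  have "irr_components (ambient n) (\<Union>(Dn_components n)) = (Dn_components n :: (hyp \<Rightarrow> 'k) set set)"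
  proof (rule irr_components_Union)
    show "finite (Dn_components n :: (hyp \<Rightarrow> 'k) set set)"
      unfolding Dn_components_eq using finite_partitions by simp
    fix C :: "(hyp \<Rightarrow> 'k) set"
    assume "C \<in> Dn_components n"
    then obtain P where P: "P \<in> partitions n" and C: "C = partition_space P"
      unfolding Dn_components_eq by blast
    note v = partitions_valid[OF P]
    have "finite P" "{} \<notin> P" using v(1,2) by (auto simp: card_ge_0_finite dest: partition_onD3)
    then show "zclosed (ambient n) C" unfolding C using v(3) by (rule partition_space_zclosed)
    show "zirreducible (ambient n) C" unfolding C by (rule partition_space_zirreducible[OF v(3)])
    fix D assume "D \<in> Dn_components n" "C \<subseteq> D"
    then show "C = D" using eq[OF P] unfolding C Dn_components_eq by blast
  qed
  then have irr: "irr_components (ambient n) (resonance1 n) = (Dn_components n :: (hyp \<Rightarrow> 'k) set set)"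
    unfolding resonance1_eq[OF assms(1)] .
  have "\<forall>C\<in>Dn_components n :: (hyp \<Rightarrow> 'k) set set. kdim C = 2"
    unfolding Dn_components_eq using kdim_partition_space partitions_valid(1,2) by blast
  moreover have "inj_on (partition_space :: _ \<Rightarrow> (hyp \<Rightarrow> 'k) set) (partitions n)"
    by (rule inj_onI) (use eq in blast)
  then have "card (Dn_components n :: (hyp \<Rightarrow> 'k) set set) = 5 * (n choose 3) + 9 * (n choose 4)"
    unfolding Dn_components_eq by (simp add: card_image card_partitions)
  ultimately show ?thesis unfolding irr by blast
qed

end
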